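(* Let $\mathcal F_n$ be $\mathcal{BC}_n$ (types $B$ and $C$) or $\mathcal D_n$ (type $D$), and let $\mathfrak F$ denote $\mathfrak B$, $\mathfrak C$ or $\mathfrak D$ according to the type. If $w\in\mathcal F_n$ and $k\geq 0$, the $k$-truncation of the double Schubert polynomial of $w$ is the sum of monomials over all reduced double signed pipe dreams (of the same type, with $k$ $\Gamma$-blocks) of shape $w$: \[ \mathfrak F^{[k]}_w(\mathbf z,\mathbf x,\mathbf t)=\sum_{D \in \mathrm{DPD}^k_{\mathcal F_n}(w)}\mathbf x^{\alpha(D)}\mathbf z^{\beta(D)}(-\mathbf t)^{\beta'(D)}. \]
   Context: **Groups.** $\mathcal{BC}_n$ is the group of permutations $w$ of $\{\pm1,\dots,\pm n\}$ with $w(-i)=-w(i)$, generated by $s_0=(1\leftrightarrow -1)$ and $s_i=(i\leftrightarrow i+1)$ (also exchanging $-i,-(i+1)$), $1\le i\le n-1$. $\mathcal D_n\subset\mathcal{BC}_n$ (here $n\ge2$) consists of those $w$ with an even number of $i\in\{1,\dots,n\}$ with $w(i)<0$; its generators are $s_1,\dots,s_{n-1}$ and $s_{\hat1}=s_0s_1s_0$. Products are compositions of maps, $(uv)(i)=u(v(i))$. Length $\ell$ and reduced words are taken with respect to the generators of the group in question. $\mathcal{BC}_\infty$, $\mathcal D_\infty$ are the unions over $n$. **Double Schubert polynomials.** Let $\mathbb Q[\mathbf z,p_1(\mathbf x),p_3(\mathbf x),\dots,\mathbf t]$ be the polynomial ring in $z_1,z_2,\dots$, $t_1,t_2,\dots$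 and the odd power sums $p_k(\mathbf x)=\sum_i x_i^k$. Define ring automorphisms: $s^z_i$ ($i\ge1$) exchanges $z_i,z_{i+1}$; $s^z_0$: $z_1\mapsto-z_1$, $p_k(\mathbf x)\mapsto p_k(\mathbf x)+z_1^k$; $s^z_{\hat1}$: $z_1\mapsto-z_2$, $z_2\mapsto-z_1$, $p_k(\mathbf x)\mapsto p_k(\mathbf x)+z_1^k+z_2^k$; $s^t_i$ ($i\ge1$) exchanges $t_i,t_{i+1}$; $s_0^t$: $t_1\mapsto-t_1$, $p_k(\mathbf x)\mapsto p_k(\mathbf x)+(-t_1)^k$; $s^t_{\hat1}$: $t_1\mapsto-t_2$, $t_2\mapsto-t_1$, $p_k(\mathbf x)\mapsto p_k(\mathbf x)+(-t_1)^k+(-t_2)^k$ (all other generators fixed). Put $\partial_i f=\frac{f-s_i^zf}{z_i-z_{i+1}}$, $\delta_if=\frac{f-s_i^tf}{t_{i+1}-t_i}$ for $i\ge1$; $\partial_0f=\frac{f-s^z_0f}{-2z_1}$, $\delta_0f=\frac{f-s_0^tf}{2t_1}$; $\partial_0^B=2\partial_0$, $\delta_0^B=2\delta_0$; $\partial_{\hat1}f=\frac{f-s^z_{\hat1}f}{-z_1-z_2}$, $\delta_{\hat1}f=\frac{f-s^t_{\hat1}f}{t_1+t_2}$. The double Schubert polynomials $\mathfrak B_w,\mathfrak C_w$ ($w\in\mathcal{BC}_\infty$), $\mathfrak D_w$ ($w\in\mathcal D_\infty$) are the unique families $\mathfrak F_w(\mathbf z,\mathbf x,\mathbf t)$ in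 this ring with $\mathfrak F_{\mathrm{id}}=1$, zero constant term for $w\ne\mathrm{id}$, and, for each index $i$ of a generator of the group, $\partial_i\mathfrak F_w=\mathfrak F_{ws_i}$ if $\ell(ws_i)<\ell(w)$ and $0$ otherwise, and $\delta_i\mathfrak F_w=\mathfrak F_{s_iw}$ if $\ell(s_iw)<\ell(w)$ and $0$ otherwise; here $i\in\{0,1,2,\dots\}$ for type $C$; the same for type $B$ but with $\partial_0^B,\delta_0^B$ in place of $\partial_0,\delta_0$; and $i\in\{\hat1,1,2,\dots\}$ for type $D$ (existence and uniqueness are due to Ikeda, Mihalcea and Naruse). The $k$-truncation is $\mathfrak F^{[k]}_w(\mathbf z,\mathbf x,\mathbf t)=\mathfrak F_w(\mathbf z;x_1,\dots,x_k,0,0,\dots;\mathbf t)$. **Double signed pipe dreams.** The base $DB^k_{\mathcal F_n}$ consists, from bottom to top, of a lower staircase block, $k$ $\Gamma$-blocks numbered $1,\dots,k$ from bottom to top, and an upper staircase block. Each staircase block has boxes $(i,j)$, $1\le i\le n-1$, $1\le j\le n-i$ (row $i$ from the top, column $j$ from the left), and the box $(i,j)$ is indexed by $i+j-1$; its variable is $z_i$ in the lower staircase block and $-t_j$ in the upper one. All boxes of the $m$-th $\Gamma$-block have variable $x_m$. The $\Gamma$-blocks are as follows. - Type $C$: a horizontal row of $n$ boxes indexed $0,\dots,n-1$ from left to right and, below it, a vertical column of $n$ boxes indexed $0,\dots,n-1$ from top to bottom. - Type $B$: a corner box indexed $0$, boxes $1,\dots,n-1$ to the right of the corner in its row (left to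 right), and boxes $1,\dots,n-1$ below the corner in its column (top to bottom). - Type $D$: a corner box indexed $1'$, boxes $2,\dots,n-1$ to the right of the corner in its row (left to right), and boxes $2,\dots,n-1$ below the corner in its column (top to bottom). A double signed pipe dream is a filling of the boxes. Each box indexed by $0$ contains an elbow (weight $0$, no letter) or an elbow with a faucet (weight $1$, letter $s_0$). Each box indexed by $1'$ contains an elbow (weight $0$, no letter), a cross (weight $1$, letter $s_1$), a cross with a faucet (weight $1$, letter $s_{\hat1}$), or an elbow with two faucets (weight $2$, the two commuting letters $s_1,s_{\hat1}$). Each other box, of index $i$, contains an elbow (weight $0$, no letter) or a cross (weight $1$, letter $s_i$). The word of $D$ is obtained by reading the letters from top to bottom and in each row from right to left: the upper staircase rows $1,\dots,n-1$, each from right to left; then the $\Gamma$-blocks $k,\dots,1$, each one by reading its horizontal boxes from right to left (in types $B$, $D$ ending with the corner) and then its vertical boxes from top to bottom; then the lower staircase rows $1,\dots,n-1$, each from right to left. (In type $D$ the two letters of an elbow with two faucets may be read in either order.) $D$ is reduced of shape $w$ if its word is a reduced word of $w\in\mathcal F_n$; $\mathrm{DPD}^k_{\mathcal F_n}(w)$ is the set of all such $D$. $\mathbf x^{\alpha(D)}\mathbf z^{\beta(D)}(-\mathbf t)^{\beta'(D)}$ is the product over all boxes of the variable of the box raised to the weight of its element. *)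

theory Defs
  imports
    Complex_Main
    "HOL-Library.Poly_Mapping"
    "HOL-Library.FuncSet"
    "HOL-Combinatorics.Permutations"
begin

datatype cltype = TypeB | TypeC | TypeD

section \<open>Signed permutations\<close>

text \<open>\<open>Gen i\<close> stands for \<open>s_i\<close> and \<open>GenHat\<close> for \<open>s_1hat\<close>.\<close>

datatype gen = Gen nat | GenHat

definition simple_refl :: "nat \<Rightarrow> int \<Rightarrow> int" where
  "simple_refl i = (if i = 0 then transpose 1 (- 1)
     else transpose (int i) (int i + 1) \<circ> transpose (- int i) (- (int i + 1)))"

fun gen_perm :: "gen \<Rightarrow> int \<Rightarrow> int" where
  "gen_perm (Gen i) = simple_refl i"
| "gen_perm GenHat = simple_refl 0 \<circ> simple_refl 1 \<circ> simple_refl 0"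

definition BC :: "nat \<Rightarrow> (int \<Rightarrow> int) set" where
  "BC n = {w. w permutes {i. i \<noteq> 0 \<and> \<bar>i\<bar> \<le> int n} \<and> (\<forall>i. w (- i) = - w i)}"

definition Dn :: "nat \<Rightarrow> (int \<Rightarrow> int) set" where
  "Dn n = {w \<in> BC n. even (card {i \<in> {1..int n}. w i < 0})}"

definition min_rank :: "cltype \<Rightarrow> nat" where
  "min_rank X = (if X = TypeD then 2 else 1)"

definition grp :: "cltype \<Rightarrow> nat \<Rightarrow> (int \<Rightarrow> int) set" where
  "grp X n = (if X = TypeD then Dn n else BC n)"

definition gens :: "cltype \<Rightarrow> nat \<Rightarrow> gen set" where
  "gens X n = (if X = TypeD then insert GenHat (Gen ` {1..<n}) else Gen ` {0..<n})"

definition grp_inf :: "cltype \<Rightarrow> (int \<Rightarrow> int) set" where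
  "grp_inf X = (\<Union>n\<in>{min_rank X..}. grp X n)"

definition gens_inf :: "cltype \<Rightarrow> gen set" where
  "gens_inf X = (\<Union>n\<in>{min_rank X..}. gens X n)"

definition word_prod :: "gen list \<Rightarrow> int \<Rightarrow> int" where
  "word_prod gs = foldr (\<lambda>g u. gen_perm g \<circ> u) gs id"

definition len :: "gen set \<Rightarrow> (int \<Rightarrow> int) \<Rightarrow> nat" where
  "len G w = (LEAST l. \<exists>gs. set gs \<subseteq> G \<and> word_prod gs = w \<and> length gs = l)"

definition reduced_word :: "gen set \<Rightarrow> gen list \<Rightarrow> (int \<Rightarrow> int) \<Rightarrow> bool" where
  "reduced_word G gs w \<longleftrightarrow> set gs \<subseteq> G \<and> word_prod gs = w \<and> length gs = len G w"

section \<open>Polynomial rings\<close>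

type_synonym 'v mpoly = "('v \<Rightarrow>\<^sub>0 nat) \<Rightarrow>\<^sub>0 rat"

definition Const :: "rat \<Rightarrow> 'v mpoly" where
  "Const c = Poly_Mapping.single 0 c"

definition Var :: "'v \<Rightarrow> 'v mpoly" where
  "Var v = Poly_Mapping.single (Poly_Mapping.single v 1) 1"

text \<open>The homomorphism of \<open>\<rat>\<close>-algebras sending each variable \<open>v\<close> to \<open>\<phi> v\<close>.\<close>

definition subst :: "('v \<Rightarrow> 'w mpoly) \<Rightarrow> 'v mpoly \<Rightarrow> 'w mpoly" where
  "subst \<phi> f = (\<Sum>m\<in>Poly_Mapping.keys f. Const (Poly_Mapping.lookup f m) *
      (\<Prod>v\<in>Poly_Mapping.keys m. \<phi> v ^ Poly_Mapping.lookup m v))"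

text \<open>The quotient \<open>f / g\<close> for \<open>g \<noteq> 0\<close> dividing \<open>f\<close>; polynomial rings being integral domains,
  it is then unique.\<close>

definition exact_quot :: "'v mpoly \<Rightarrow> 'v mpoly \<Rightarrow> 'v mpoly" where
  "exact_quot f g = (THE q. q * g = f)"

text \<open>The generators of \<open>\<rat>[z, p\<^sub>1(x), p\<^sub>3(x), \<dots>, t]\<close>. So that this ring is the whole type, with no
  superfluous variables, \<open>SZ j\<close> is \<open>z_(j+1)\<close>, \<open>SP m\<close> is \<open>p_(2m+1)(x)\<close> and \<open>ST j\<close> is \<open>t_(j+1)\<close>.
  The odd power sums in infinitely many variables are algebraically independent over \<open>\<rat>\<close>, hence
  may be taken as indeterminates.\<close>

datatype svar = SZ nat | SP nat | ST nat

text \<open>\<open>z i\<close> and \<open>t i\<close>, as in the mathematics, for \<open>i \<ge> 1\<close>.\<close>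

abbreviation sz :: "nat \<Rightarrow> svar mpoly" where "sz i \<equiv> Var (SZ (i - 1))"
abbreviation st :: "nat \<Rightarrow> svar mpoly" where "st i \<equiv> Var (ST (i - 1))"

text \<open>The images of the generators under \<open>s_g^z\<close> and \<open>s_g^t\<close>. For \<open>i \<ge> 1\<close>, exchanging \<open>z_i\<close> and
  \<open>z_(i+1)\<close> means exchanging \<open>SZ (i - 1)\<close> and \<open>SZ i\<close>.\<close>

fun z_image :: "gen \<Rightarrow> svar \<Rightarrow> svar mpoly" where
  "z_image (Gen 0) (SZ j) = (if j = 0 then - sz 1 else Var (SZ j))"
| "z_image (Gen 0) (SP m) = Var (SP m) + sz 1 ^ (2 * m + 1)"
| "z_image (Gen (Suc i)) (SZ j) = Var (SZ (transpose i (Suc i) j))"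
| "z_image (Gen (Suc i)) (SP m) = Var (SP m)"
| "z_image GenHat (SZ j) = (if j = 0 then - sz 2 else if j = 1 then - sz 1 else Var (SZ j))"
| "z_image GenHat (SP m) = Var (SP m) + sz 1 ^ (2 * m + 1) + sz 2 ^ (2 * m + 1)"
| "z_image g (ST j) = Var (ST j)"

fun t_image :: "gen \<Rightarrow> svar \<Rightarrow> svar mpoly" where
  "t_image (Gen 0) (ST j) = (if j = 0 then - st 1 else Var (ST j))"
| "t_image (Gen 0) (SP m) = Var (SP m) + (- st 1) ^ (2 * m + 1)"
| "t_image (Gen (Suc i)) (ST j) = Var (ST (transpose i (Suc i) j))"
| "t_image (Gen (Suc i)) (SP m) = Var (SP m)"
| "t_image GenHat (ST j) = (if j = 0 then - st 2 else if j = 1 then - st 1 else Var (ST j))"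
| "t_image GenHat (SP m) = Var (SP m) + (- st 1) ^ (2 * m + 1) + (- st 2) ^ (2 * m + 1)"
| "t_image g (SZ j) = Var (SZ j)"

fun z_denom :: "gen \<Rightarrow> svar mpoly" where
  "z_denom (Gen 0) = - (2 * sz 1)"
| "z_denom (Gen (Suc i)) = sz (Suc i) - sz (Suc (Suc i))"
| "z_denom GenHat = - sz 1 - sz 2"

fun t_denom :: "gen \<Rightarrow> svar mpoly" where
  "t_denom (Gen 0) = 2 * st 1"
| "t_denom (Gen (Suc i)) = st (Suc (Suc i)) - st (Suc i)"
| "t_denom GenHat = st 1 + st 2"

text \<open>The operators \<open>\<partial>_g\<close> and \<open>\<delta>_g\<close>, and their versions for each type, which differ from these
  only by the factor 2 in \<open>\<partial>_0^B\<close> and \<open>\<delta>_0^B\<close>.\<close>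

definition ddz :: "gen \<Rightarrow> svar mpoly \<Rightarrow> svar mpoly" where
  "ddz g f = exact_quot (f - subst (z_image g) f) (z_denom g)"

definition ddt :: "gen \<Rightarrow> svar mpoly \<Rightarrow> svar mpoly" where
  "ddt g f = exact_quot (f - subst (t_image g) f) (t_denom g)"

definition ddz_type :: "cltype \<Rightarrow> gen \<Rightarrow> svar mpoly \<Rightarrow> svar mpoly" where
  "ddz_type X g f = (if X = TypeB \<and> g = Gen 0 then 2 * ddz g f else ddz g f)"

definition ddt_type :: "cltype \<Rightarrow> gen \<Rightarrow> svar mpoly \<Rightarrow> svar mpoly" where
  "ddt_type X g f = (if X = TypeB \<and> g = Gen 0 then 2 * ddt g f else ddt g f)"

section \<open>Double Schubert polynomials\<close>

text \<open>The conditions that characterise the family of double Schubert polynomials of type \<open>X\<close>.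
  By Ikeda, Mihalcea and Naruse exactly one family indexed by \<open>grp_inf X\<close> satisfies them; the
  values of \<open>F\<close> outside \<open>grp_inf X\<close> are irrelevant.\<close>

definition double_schubert :: "cltype \<Rightarrow> ((int \<Rightarrow> int) \<Rightarrow> svar mpoly) \<Rightarrow> bool" where
  "double_schubert X F \<longleftrightarrow>
     F id = 1 \<and>
     (\<forall>w\<in>grp_inf X. w \<noteq> id \<longrightarrow> Poly_Mapping.lookup (F w) 0 = 0) \<and>
     (\<forall>w\<in>grp_inf X. \<forall>g\<in>gens_inf X.
        ddz_type X g (F w) =
          (if len (gens_inf X) (w \<circ> gen_perm g) < len (gens_inf X) w then F (w \<circ> gen_perm g) else 0) \<and>
        ddt_type X g (F w) =
          (if len (gens_inf X) (gen_perm g \<circ> w) < len (gens_inf X) w then F (gen_perm g \<circ> w) else 0))"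

text \<open>The variables of \<open>\<rat>[z, x, t]\<close>, with the same shift of indices as for \<^typ>\<open>svar\<close>.\<close>

datatype pvar = PZ nat | PX nat | PT nat

abbreviation pz :: "nat \<Rightarrow> pvar mpoly" where "pz i \<equiv> Var (PZ (i - 1))"
abbreviation px :: "nat \<Rightarrow> pvar mpoly" where "px i \<equiv> Var (PX (i - 1))"
abbreviation pt :: "nat \<Rightarrow> pvar mpoly" where "pt i \<equiv> Var (PT (i - 1))"

fun truncation_image :: "nat \<Rightarrow> svar \<Rightarrow> pvar mpoly" where
  "truncation_image k (SZ j) = Var (PZ j)"
| "truncation_image k (SP m) = (\<Sum>i=1..k. px i ^ (2 * m + 1))"
| "truncation_image k (ST j) = Var (PT j)"

definition truncation :: "nat \<Rightarrow> svar mpoly \<Rightarrow> pvar mpoly" where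
  "truncation k = subst (truncation_image k)"

section \<open>Double signed pipe dreams\<close>

text \<open>\<open>Lower i j\<close> and \<open>Upper i j\<close> are the boxes \<open>(i, j)\<close> of the two staircase blocks. \<open>Corner m\<close> is
  the corner box of the \<open>m\<close>-th \<open>\<Gamma>\<close>-block (types B and D), \<open>Horiz m i\<close> and \<open>Vert m i\<close> are the boxes
  indexed \<open>i\<close> in its row and its column.\<close>

datatype box = Lower nat nat | Upper nat nat | Corner nat | Horiz nat nat | Vert nat nat

datatype index = Idx nat | OnePrime

fun box_index :: "cltype \<Rightarrow> box \<Rightarrow> index" where
  "box_index X (Lower i j) = Idx (i + j - 1)"
| "box_index X (Upper i j) = Idx (i + j - 1)"
| "box_index X (Corner m) = (if X = TypeD then OnePrime else Idx 0)"
| "box_index X (Horiz m i) = Idx i"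
| "box_index X (Vert m i) = Idx i"

text \<open>The value for \<open>Upper i j\<close> carries the sign of \<open>-t_j\<close>.\<close>

fun box_var :: "box \<Rightarrow> pvar mpoly" where
  "box_var (Lower i j) = pz i"
| "box_var (Upper i j) = - pt j"
| "box_var (Corner m) = px m"
| "box_var (Horiz m i) = px m"
| "box_var (Vert m i) = px m"

text \<open>The boxes of the base, listed in the order in which the word is read: upper staircase block,
  \<open>\<Gamma>\<close>-blocks \<open>k, \<dots>, 1\<close>, lower staircase block.\<close>

definition staircase_order :: "(nat \<Rightarrow> nat \<Rightarrow> box) \<Rightarrow> nat \<Rightarrow> box list" where
  "staircase_order B n = concat (map (\<lambda>i. map (B i) (rev [1..<Suc (n - i)])) [1..<n])"

fun gamma_order :: "cltype \<Rightarrow> nat \<Rightarrow> nat \<Rightarrow> box list" where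
  "gamma_order TypeB n m = map (Horiz m) (rev [1..<n]) @ [Corner m] @ map (Vert m) [1..<n]"
| "gamma_order TypeC n m = map (Horiz m) (rev [0..<n]) @ map (Vert m) [0..<n]"
| "gamma_order TypeD n m = map (Horiz m) (rev [2..<n]) @ [Corner m] @ map (Vert m) [2..<n]"

definition reading_order :: "cltype \<Rightarrow> nat \<Rightarrow> nat \<Rightarrow> box list" where
  "reading_order X n k =
     staircase_order Upper n @
     concat (map (gamma_order X n) (rev [1..<Suc k])) @
     staircase_order Lower n"

definition base :: "cltype \<Rightarrow> nat \<Rightarrow> nat \<Rightarrow> box set" where
  "base X n k = set (reading_order X n k)"

datatype tile = Elbow | Cross | ElbowFaucet | CrossFaucet | ElbowTwoFaucets

fun tiles :: "index \<Rightarrow> tile set" where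
  "tiles (Idx 0) = {Elbow, ElbowFaucet}"
| "tiles (Idx (Suc i)) = {Elbow, Cross}"
| "tiles OnePrime = {Elbow, Cross, CrossFaucet, ElbowTwoFaucets}"

fun weight :: "tile \<Rightarrow> nat" where
  "weight Elbow = 0"
| "weight Cross = 1"
| "weight ElbowFaucet = 1"
| "weight CrossFaucet = 1"
| "weight ElbowTwoFaucets = 2"

text \<open>Only the values at tiles allowed in the box matter. The two letters of an elbow with two
  faucets commute, so their order is immaterial.\<close>

fun letters :: "index \<Rightarrow> tile \<Rightarrow> gen list" where
  "letters (Idx 0) ElbowFaucet = [Gen 0]"
| "letters (Idx (Suc i)) Cross = [Gen (Suc i)]"
| "letters OnePrime Cross = [Gen 1]"
| "letters OnePrime CrossFaucet = [GenHat]"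
| "letters OnePrime ElbowTwoFaucets = [Gen 1, GenHat]"
| "letters _ _ = []"

definition fillings :: "cltype \<Rightarrow> nat \<Rightarrow> nat \<Rightarrow> (box \<Rightarrow> tile) set" where
  "fillings X n k = (\<Pi>\<^sub>E b\<in>base X n k. tiles (box_index X b))"

definition pd_word :: "cltype \<Rightarrow> nat \<Rightarrow> nat \<Rightarrow> (box \<Rightarrow> tile) \<Rightarrow> gen list" where
  "pd_word X n k D = concat (map (\<lambda>b. letters (box_index X b) (D b)) (reading_order X n k))"

definition DPD :: "cltype \<Rightarrow> nat \<Rightarrow> nat \<Rightarrow> (int \<Rightarrow> int) \<Rightarrow> (box \<Rightarrow> tile) set" where
  "DPD X n k w = {D \<in> fillings X n k. reduced_word (gens X n) (pd_word X n k D) w}"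

definition pd_monomial :: "cltype \<Rightarrow> nat \<Rightarrow> nat \<Rightarrow> (box \<Rightarrow> tile) \<Rightarrow> pvar mpoly" where
  "pd_monomial X n k D = (\<Prod>b\<in>base X n k. box_var b ^ weight (D b))"

end

theory Submission
  imports Defs
begin

text \<open>Evaluate \<open>F w\<close> at a point \<open>(z, p, t)\<close> and collect the values in the element
  \<open>E(z, p) = \<Sum>\<^sub>w F w u\<^sub>w\<close> of the nilCoxeter algebra, with \<open>t\<close> fixed. Replacing
  \<open>(z, p)\<close> by its image under a generator \<open>s_g\<close> multiplies \<open>E\<close> from the right by
  \<open>1 + c u_g\<close>, where \<open>c\<close> is a linear form in \<open>z\<close>; moreover \<open>E = 1\<close> at \<open>z = t\<close>,
  \<open>p = 0\<close>, and on the group of rank \<open>n\<close> only \<open>z_1, \<dots>, z_(n-1)\<close> matter, so that \<open>z_n\<close>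
  may be overwritten at will. Starting from \<open>z = t\<close>, moving zeros from position \<open>n\<close> to the
  front gives the factors of the upper staircase block; moving a new entry \<open>x_m\<close> from position
  \<open>n\<close> to the front, reflecting it to \<open>-x_m\<close> (which adds its powers to \<open>p\<close>) and moving it
  back gives those of a \<open>\<Gamma>\<close>-block; bringing in \<open>z_1, z_2, \<dots>\<close> one after the other gives
  those of the lower staircase block. Expanding the product yields the sum over reduced pipe
  dreams.\<close>

section \<open>Substitution\<close>

fun svar_code :: "svar \<Rightarrow> nat" where
  "svar_code (SZ j) = 3 * j"
| "svar_code (SP j) = 3 * j + 1"
| "svar_code (ST j) = 3 * j + 2"

lemma svar_code_inject: "svar_code u = svar_code v \<Longrightarrow> u = v"
  by (cases u; cases v; simp; presburger)

text \<open>Any linear order on the variables will do: it gives the polynomial ring its instance of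
  class \<open>idom\<close>.\<close>

instantiation svar :: linorder
begin

definition "u \<le> v \<longleftrightarrow> svar_code u \<le> svar_code v"
definition "u < v \<longleftrightarrow> svar_code u < svar_code v"

instance
  by standard (auto simp: less_eq_svar_def less_svar_def intro: svar_code_inject)

end

definition monom_value :: "('v \<Rightarrow> 'w mpoly) \<Rightarrow> ('v \<Rightarrow>\<^sub>0 nat) \<Rightarrow> 'w mpoly" where
  "monom_value \<phi> m = (\<Prod>v\<in>Poly_Mapping.keys m. \<phi> v ^ Poly_Mapping.lookup m v)"

text \<open>Exponent vectors with different supports are multiplied after extending both products to
  a common finite index set; the extra factors have exponent 0.\<close>

lemma monom_value_superset:
  assumes "finite A" "Poly_Mapping.keys m \<subseteq> A"
  shows "monom_value \<phi> m = (\<Prod>v\<in>A. \<phi> v ^ Poly_Mapping.lookup m v)"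
  unfolding monom_value_def using assms
  by (intro prod.mono_neutral_left) (auto simp: in_keys_iff)

lemma monom_value_add: "monom_value \<phi> (m + m') = monom_value \<phi> m * monom_value \<phi> m'"
proof -
  let ?A = "Poly_Mapping.keys m \<union> Poly_Mapping.keys m'"
  have "finite ?A" by simp
  then show ?thesis
    using Poly_Mapping.keys_add[of m m']
    by (simp add: monom_value_superset[of ?A] lookup_add power_add prod.distrib)
qed

lemma subst_superset:
  assumes "finite A" "Poly_Mapping.keys f \<subseteq> A"
  shows "subst \<phi> f = (\<Sum>m\<in>A. Const (Poly_Mapping.lookup f m) * monom_value \<phi> m)"
  unfolding subst_def monom_value_def using assms
  by (intro sum.mono_neutral_left) (auto simp: in_keys_iff Const_def)

lemma Const_add: "Const (a + b) = Const a + Const b"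
  by (simp add: Const_def single_add)

lemma Const_mult: "Const (a * b) = Const a * Const b"
  by (simp add: Const_def mult_single)

lemma Const_1: "Const 1 = 1"
  by (simp add: Const_def)

lemma Const_0: "Const 0 = 0"
  by (simp add: Const_def)

lemma subst_add: "subst \<phi> (f + g) = subst \<phi> f + subst \<phi> g"
proof -
  let ?A = "Poly_Mapping.keys f \<union> Poly_Mapping.keys g"
  have "finite ?A" by simp
  then show ?thesis
    using Poly_Mapping.keys_add[of f g]
    by (simp add: subst_superset[of ?A] lookup_add Const_add sum.distrib algebra_simps)
qed

lemma subst_single: "subst \<phi> (Poly_Mapping.single m c) = Const c * monom_value \<phi> m"
  by (subst subst_superset[of "{m}"]) auto

lemma subst_0 [simp]: "subst \<phi> 0 = 0"
  by (simp add: subst_def)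

lemma mpoly_monomial_induct [case_names zero single add]:
  fixes f :: "'v mpoly"
  assumes "P 0" "\<And>m c. P (Poly_Mapping.single m c)" "\<And>f g. P f \<Longrightarrow> P g \<Longrightarrow> P (f + g)"
  shows "P f"
proof -
  have "f = (\<Sum>m\<in>Poly_Mapping.keys f. Poly_Mapping.single m (Poly_Mapping.lookup f m))"
    by (rule poly_mapping_eqI)
      (auto simp: lookup_sum lookup_single when_def in_keys_iff)
  moreover have "P (\<Sum>m\<in>A. Poly_Mapping.single m (Poly_Mapping.lookup f m))" if "finite A" for A
    using that by (induction A) (auto intro: assms)
  ultimately show ?thesis
    by (metis finite_keys)
qed

text \<open>Both sides are additive in each argument, so it suffices to treat two monomials.\<close>

lemma subst_mult: "subst \<phi> (f * g) = subst \<phi> f * subst \<phi> g"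
proof (induction f rule: mpoly_monomial_induct)
  case (single m c)
  show ?case
  proof (induction g rule: mpoly_monomial_induct)
    case (single m' c')
    show ?case
      by (simp add: mult_single subst_single Const_mult monom_value_add)
  qed (auto simp: subst_add algebra_simps)
qed (auto simp: subst_add algebra_simps)

lemma subst_Const [simp]: "subst \<phi> (Const c) = Const c"
  by (simp add: Const_def subst_single monom_value_def)

lemma subst_Var [simp]: "subst \<phi> (Var v) = \<phi> v"
  by (simp add: Var_def subst_single monom_value_def Const_1)

lemma subst_1 [simp]: "subst \<phi> 1 = 1"
  using subst_Const[of \<phi> 1] by (simp add: Const_1)

lemma subst_uminus: "subst \<phi> (- f) = - subst \<phi> f"
proof -
  have "subst \<phi> (- f + f) = 0" by simp
  then show ?thesis by (metis add_eq_0_iff subst_add add.commute)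
qed

lemma subst_diff: "subst \<phi> (f - g) = subst \<phi> f - subst \<phi> g"
  using subst_add[of \<phi> f "- g"] by (simp add: subst_uminus)

lemma subst_power: "subst \<phi> (f ^ n) = subst \<phi> f ^ n"
  by (induction n) (auto simp: subst_mult)

lemma subst_numeral [simp]: "subst \<phi> (numeral n) = numeral n"
proof -
  have "numeral n = Const (numeral n)"
    by (simp add: Const_def)
  then show ?thesis by (metis subst_Const Const_def single_numeral)
qed

lemmas subst_simps = subst_add subst_mult subst_uminus subst_diff subst_power

text \<open>Turns a monomial stored as an exponent vector into an actual product of variables, which
  is what induction over sums and products (\<open>mpoly_induct\<close>) requires.\<close>

lemma single_eq_Const_times_vars:
  "Poly_Mapping.single m c = Const c * monom_value Var m"
proof -
  have *: "Var v ^ i = Poly_Mapping.single (Poly_Mapping.single v i) 1" for v :: 'a and i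
    by (induction i) (auto simp: Var_def mult_single single_add[symmetric])
  have "(\<Prod>v\<in>A. Poly_Mapping.single (Poly_Mapping.single v (Poly_Mapping.lookup m v)) (1::rat))
      = Poly_Mapping.single (\<Sum>v\<in>A. Poly_Mapping.single v (Poly_Mapping.lookup m v)) 1"
    if "finite A" for A
    using that by (induction A) (auto simp: mult_single)
  moreover have "m = (\<Sum>v\<in>Poly_Mapping.keys m. Poly_Mapping.single v (Poly_Mapping.lookup m v))"
    by (rule poly_mapping_eqI)
      (auto simp: lookup_sum lookup_single when_def in_keys_iff)
  ultimately have "monom_value Var m = Poly_Mapping.single m 1"
    by (simp add: monom_value_def *)
  then show ?thesis
    by (simp add: Const_def mult_single)
qed

lemma mpoly_induct [case_names Const Var add mult]:
  fixes f :: "'v mpoly"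
  assumes "\<And>c. P (Const c)" "\<And>v. P (Var v)"
    and "\<And>f g. P f \<Longrightarrow> P g \<Longrightarrow> P (f + g)" "\<And>f g. P f \<Longrightarrow> P g \<Longrightarrow> P (f * g)"
  shows "P f"
proof (induction f rule: mpoly_monomial_induct)
  case zero
  show ?case using assms(1)[of 0] by (simp add: Const_0)
next
  case (single m c)
  have P1: "P 1" using assms(1)[of 1] by (simp add: Const_1)
  have pow: "P (Var v ^ i)" for v i
    by (induction i) (auto intro: assms P1)
  have "P (\<Prod>v\<in>A. Var v ^ Poly_Mapping.lookup m v)" if "finite A" for A
    using that by (induction A) (auto intro: assms pow P1)
  then show ?case
    unfolding single_eq_Const_times_vars monom_value_def by (intro assms) auto
qed (rule assms)

lemma subst_subst: "subst \<phi> (subst \<psi> f) = subst (\<lambda>v. subst \<phi> (\<psi> v)) f"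
  by (induction f rule: mpoly_induct) (auto simp: subst_simps)

text \<open>At the origin every monomial with nonempty support vanishes.\<close>

lemma subst_const_coeff:
  assumes "\<And>v. \<phi> v = 0"
  shows "subst \<phi> f = Const (Poly_Mapping.lookup f 0)"
proof -
  have "monom_value \<phi> m = (if m = 0 then 1 else 0)" for m
  proof (cases "m = 0")
    case False
    then obtain v where "v \<in> Poly_Mapping.keys m" by fastforce
    then show ?thesis using False
      by (auto simp: monom_value_def assms in_keys_iff power_0_left)
  qed (simp add: monom_value_def)
  then have *: "monom_value \<phi> = (\<lambda>m. if m = 0 then 1 else 0)" by auto
  show ?thesis
    by (subst subst_superset[of "insert 0 (Poly_Mapping.keys f)"])
      (auto simp: * if_distrib[of "(*) _"] simp del: sum.insert_if cong: if_cong)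
qed

lemma subst_finite_dependence:
  obtains V where "finite V" "\<And>\<phi> \<psi> :: 'v \<Rightarrow> 'w mpoly. (\<And>v. v \<in> V \<Longrightarrow> \<phi> v = \<psi> v) \<Longrightarrow> subst \<phi> f = subst \<psi> f"
proof
  let ?V = "\<Union>m\<in>Poly_Mapping.keys f. Poly_Mapping.keys m"
  show "finite ?V" by simp
  show "subst \<phi> f = subst \<psi> f" if "\<And>v. v \<in> ?V \<Longrightarrow> \<phi> v = \<psi> v"
    for \<phi> \<psi> :: "'v \<Rightarrow> 'w mpoly"
    unfolding subst_def
  proof (intro sum.cong refl arg_cong2[where f = "(*)"] prod.cong)
    fix m v assume "m \<in> Poly_Mapping.keys f" "v \<in> Poly_Mapping.keys m"
    then show "\<phi> v ^ Poly_Mapping.lookup m v = \<psi> v ^ Poly_Mapping.lookup m v"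
      using that[OF UN_I] by simp
  qed
qed

section \<open>Divided differences\<close>

text \<open>Modulo \<open>d\<close> the substitution fixes the variables, hence everything they
  generate.\<close>

lemma dvd_diff_subst:
  fixes d :: "'v mpoly"
  assumes "\<And>v. d dvd Var v - \<sigma> v"
  shows "d dvd f - subst \<sigma> f"
proof (induction f rule: mpoly_induct)
  case (add f g)
  have "f + g - subst \<sigma> (f + g) = (f - subst \<sigma> f) + (g - subst \<sigma> g)"
    by (simp add: subst_add)
  then show ?case by (metis add.IH dvd_add)
next
  case (mult f g)
  have "f * g - subst \<sigma> (f * g) = (f - subst \<sigma> f) * g + subst \<sigma> f * (g - subst \<sigma> g)"
    by (simp add: subst_mult algebra_simps)
  then show ?case by (metis mult.IH dvd_add dvd_mult dvd_mult2)
qed (auto simp: assms)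

text \<open>The ring is an integral domain, so the quotient described by \<open>THE\<close> is
  unique.\<close>

lemma exact_quot_mult:
  fixes f g :: "svar mpoly"
  assumes "g dvd f" "g \<noteq> 0"
  shows "exact_quot f g * g = f"
proof -
  from assms(1) obtain q where q: "q * g = f" by (metis dvdE mult.commute)
  have "q' = q" if "q' * g = f" for q'
  proof -
    have "q' * g = q * g" using that q by metis
    then show ?thesis using assms(2) by (rule mult_right_cancel[THEN iffD1, rotated])
  qed
  with q have "exact_quot f g = q"
    unfolding exact_quot_def by (rule the_equality)
  with q show ?thesis by metis
qed

text \<open>Serves for \<open>GenHat\<close>, which changes the odd power sums by such a sum of two
  powers.\<close>

lemma dvd_odd_power_sum:
  fixes x y :: "'a :: comm_ring_1"
  shows "x + y dvd x ^ (2 * m + 1) + y ^ (2 * m + 1)"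
proof (induction m)
  case (Suc m)
  have "x ^ (2 * Suc m + 1) + y ^ (2 * Suc m + 1) =
    x\<^sup>2 * (x ^ (2 * m + 1) + y ^ (2 * m + 1)) + (x + y) * (y ^ (2 * m + 1) * (y - x))"
    by (simp add: algebra_simps power2_eq_square)
  then show ?case using Suc by (metis dvd_add dvd_mult dvd_triv_left)
qed simp

lemma half_two: "Const (1/2) * (2 :: 'v mpoly) = 1"
proof -
  have "Const (1/2) * (2 :: 'v mpoly) = Const (1/2) * Const 2"
    by (simp add: Const_def)
  also have "\<dots> = Const (1/2 * 2)"
    by (rule Const_mult[symmetric])
  also have "\<dots> = 1"
    by (simp add: Const_1)
  finally show ?thesis .
qed

lemma z_denom_nonzero: "z_denom g \<noteq> 0"
proof
  assume *: "z_denom g = 0"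
  \<comment> \<open>A point at which every denominator takes one of the nonzero values 1 and
    -2.\<close>
  define \<phi> :: "svar \<Rightarrow> svar mpoly" where
    "\<phi> v = (case v of SZ j \<Rightarrow> (case g of Gen (Suc i) \<Rightarrow> (if j = i then 1 else 0) | _ \<Rightarrow> 1) | _ \<Rightarrow> 0)" for v
  have "subst \<phi> (z_denom g) = 0" using * by simp
  moreover have "subst \<phi> (z_denom g) \<in> {1, -2}"
    by (cases g rule: z_denom.cases) (auto simp: subst_simps \<phi>_def)
  moreover have "(-2 :: svar mpoly) \<noteq> 0" by simp
  ultimately show False by auto
qed

lemma t_denom_nonzero: "t_denom (Gen (Suc i)) \<noteq> 0"
proof
  assume *: "t_denom (Gen (Suc i)) = 0"
  define \<phi> :: "svar \<Rightarrow> svar mpoly" where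
    "\<phi> v = (if v = ST i then 1 else 0)" for v
  have "subst \<phi> (t_denom (Gen (Suc i))) = 0" using * by simp
  then show False by (simp add: subst_simps \<phi>_def)
qed

lemma z_denom_dvd: "z_denom g dvd f - subst (z_image g) f"
proof (rule dvd_diff_subst)
  \<comment> \<open>The factor 2 in the denominator for \<open>Gen 0\<close> is a unit over the
    rationals.\<close>
  have gen0: "- (2 * a) dvd b" if "a dvd b" for a b :: "svar mpoly"
  proof -
    from that obtain c where "b = a * c" by (auto simp: dvd_def)
    then have "b = - (2 * a) * (- Const (1/2) * c)"
      using half_two by (metis (no_types, lifting) mult.assoc mult.commute mult.left_commute mult_1 mult_minus_left mult_minus_right minus_minus)
    then show ?thesis by (metis dvd_triv_left)
  qed
  fix v
  show "z_denom g dvd Var v - z_image g v"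
  proof (cases "(g, v)" rule: z_image.cases)
    case (1 j)
    then show ?thesis by (auto intro!: gen0 simp: mult_2[symmetric])
  next
    case (2 m)
    have "Var (SZ 0) dvd - (Var (SZ 0) ^ (2 * m + 1) :: svar mpoly)" by simp
    from gen0[OF this] show ?thesis using 2 by (simp add: algebra_simps)
  next
    case (3 i j)
    have "a - b dvd b - a" for a b :: "svar mpoly" by (metis dvd_refl dvd_minus_iff minus_diff_eq)
    then show ?thesis using 3 by (auto simp: transpose_def)
  next
    case (5 j)
    have "- a - b dvd a + b" "- a - b dvd b + a" for a b :: "svar mpoly"
      by (metis dvd_refl dvd_minus_iff minus_add_distrib uminus_add_conv_diff add.commute diff_conv_add_uminus)+
    then show ?thesis using 5 by auto
  next
    case (6 m)
    let ?x = "Var (SZ 0) :: svar mpoly" and ?y = "Var (SZ 1) :: svar mpoly"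
    have "- ?x - ?y dvd - (?x ^ (2*m+1) + ?y ^ (2*m+1))"
      using dvd_odd_power_sum[of ?x ?y m]
      by (metis dvd_minus_iff minus_dvd_iff minus_add_distrib diff_conv_add_uminus)
    then show ?thesis using 6 by (simp add: algebra_simps)
  qed auto
qed

lemma t_denom_dvd: "t_denom (Gen (Suc i)) dvd f - subst (t_image (Gen (Suc i))) f"
proof (rule dvd_diff_subst)
  fix v
  have "a - b dvd b - a" for a b :: "svar mpoly" by (metis dvd_refl dvd_minus_iff minus_diff_eq)
  then show "t_denom (Gen (Suc i)) dvd Var v - t_image (Gen (Suc i)) v"
    by (cases v) (auto simp: transpose_def)
qed

text \<open>Read this way, a divided difference tells how values change when the variables are
  reflected.\<close>

lemma subst_z_image: "subst (z_image g) f = f - ddz g f * z_denom g"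
  using exact_quot_mult[OF z_denom_dvd[of g f] z_denom_nonzero] by (simp add: ddz_def)

lemma subst_t_image:
  "subst (t_image (Gen (Suc i))) f = f - ddt (Gen (Suc i)) f * t_denom (Gen (Suc i))"
  using exact_quot_mult[OF t_denom_dvd[of i f] t_denom_nonzero] by (simp add: ddt_def)

section \<open>Lengths in the signed permutation groups\<close>

lemma gen_perm_Gen_0: "gen_perm (Gen 0) i = (if \<bar>i\<bar> = 1 then - i else i)"
  by (auto simp: simple_refl_def transpose_def)

lemma gen_perm_Gen_Suc:
  "gen_perm (Gen (Suc k)) i =
    (if i = int k + 1 then int k + 2 else if i = int k + 2 then int k + 1
     else if i = - int k - 1 then - int k - 2 else if i = - int k - 2 then - int k - 1 else i)"
  by (auto simp: simple_refl_def transpose_def)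

lemma gen_perm_GenHat:
  "gen_perm GenHat i =
    (if i = 1 then - 2 else if i = 2 then - 1 else if i = - 1 then 2 else if i = - 2 then 1 else i)"
  by (auto simp: simple_refl_def transpose_def)

lemmas gen_perm_apply = gen_perm_Gen_0 gen_perm_Gen_Suc gen_perm_GenHat

declare gen_perm.simps [simp del]

lemma gen_cases [case_names Gen_0 Gen_Suc GenHat]:
  obtains "g = Gen 0" | k where "g = Gen (Suc k)" | "g = GenHat"
  by (metis gen.exhaust not0_implies_Suc)

lemma gen_perm_uminus: "gen_perm g (- i) = - gen_perm g i"
  by (cases g rule: gen_cases) (auto simp: gen_perm_apply)

lemma gen_perm_involution [simp]: "gen_perm g (gen_perm g i) = i"
  by (cases g rule: gen_cases) (auto simp: gen_perm_apply)

lemma gen_perm_comp_self: "w \<circ> gen_perm g \<circ> gen_perm g = w"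
  by auto

lemma inj_gen_perm: "inj (gen_perm g)"
  by (metis gen_perm_involution injI)

lemma gen_perm_0 [simp]: "gen_perm g 0 = 0"
  by (cases g rule: gen_cases) (auto simp: gen_perm_apply)

lemma gen_perm_eq_0_iff [simp]: "gen_perm g i = 0 \<longleftrightarrow> i = 0"
  by (metis gen_perm_0 gen_perm_involution)

text \<open>A generator is the reflection that exchanges the two entries of its root.\<close>

fun gen_root :: "gen \<Rightarrow> int \<times> int" where
  "gen_root (Gen 0) = (- 1, 1)"
| "gen_root (Gen (Suc k)) = (int k + 1, int k + 2)"
| "gen_root GenHat = (- 1, 2)"

definition right_descent :: "(int \<Rightarrow> int) \<Rightarrow> gen \<Rightarrow> bool" where
  "right_descent w g \<longleftrightarrow> w (snd (gen_root g)) < w (fst (gen_root g))"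

text \<open>The pairs stand for positive roots; type D has no root that belongs to a sign change of
  a single entry, so the pairs \<open>(- j, j)\<close> are left out there.\<close>

definition inv_pairs :: "cltype \<Rightarrow> (int \<Rightarrow> int) \<Rightarrow> (int \<times> int) set" where
  "inv_pairs X w = {(i, j). i < j \<and> i \<noteq> 0 \<and> j \<noteq> 0 \<and> (X = TypeD \<longrightarrow> i \<noteq> - j) \<and> w j < w i}"

text \<open>For a signed permutation, \<open>(i, j)\<close> and \<open>(-j, -i)\<close> are the same inversion.\<close>

fun pair_class :: "int \<times> int \<Rightarrow> (int \<times> int) set" where
  "pair_class (i, j) = {(i, j), (- j, - i)}"

definition inversions :: "cltype \<Rightarrow> (int \<Rightarrow> int) \<Rightarrow> (int \<times> int) set set" where
  "inversions X w = pair_class ` inv_pairs X w"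

lemma gens_inf_eq: "gens_inf X = (if X = TypeD then insert GenHat (Gen ` {1..}) else range Gen)"
proof -
  have "\<exists>n\<in>{min_rank X..}. i < n" for i
    by (rule bexI[of _ "Suc (Suc i)"]) (auto simp: min_rank_def)
  then show ?thesis
    unfolding gens_inf_def gens_def by (fastforce simp: image_iff)
qed

lemma gens_subset_gens_inf: "min_rank X \<le> n \<Longrightarrow> gens X n \<subseteq> gens_inf X"
  by (auto simp: gens_inf_def)

lemma gen_root_properties:
  assumes "g \<in> gens_inf X" "gen_root g = (a, b)"
  shows "gen_perm g a = b" "gen_perm g b = a" "a < b" "a \<noteq> 0" "b \<noteq> 0" "X = TypeD \<Longrightarrow> a \<noteq> - b"
  using assms
  by (cases g rule: gen_cases; auto simp: gen_perm_apply gens_inf_eq split: if_splits)+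

text \<open>A simple reflection permutes the positive roots other than its own;
  \<open>(a, b)\<close> and \<open>(- b, - a)\<close> are the two representatives of the
  latter.\<close>

lemma gen_perm_less:
  assumes "g \<in> gens_inf X" "gen_root g = (a, b)" "i < j" "i \<noteq> 0" "j \<noteq> 0" "X = TypeD \<Longrightarrow> i \<noteq> - j"
    and "(i, j) \<noteq> (a, b)" "(i, j) \<noteq> (- b, - a)"
  shows "gen_perm g i < gen_perm g j"
proof (cases g rule: gen_cases)
  case Gen_0
  have "i \<noteq> - 1 \<or> j \<noteq> 1" using assms(2,7) Gen_0 by auto
  then show ?thesis using assms(3-5) unfolding Gen_0 gen_perm_Gen_0 by (smt (verit))
next
  case (Gen_Suc k)
  have "i \<noteq> int k + 1 \<or> j \<noteq> int k + 2" "i \<noteq> - int k - 2 \<or> j \<noteq> - int k - 1"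
    using assms(2,7,8) Gen_Suc by auto
  moreover have "0 \<le> int k" by simp
  ultimately show ?thesis using assms(3-5) unfolding Gen_Suc gen_perm_Gen_Suc by (smt (verit))
next
  case GenHat
  then have "X = TypeD" using assms(1) by (auto simp: gens_inf_eq split: if_splits)
  then have "i \<noteq> - j" using assms(6) by simp
  moreover have "i \<noteq> - 1 \<or> j \<noteq> 2" "i \<noteq> - 2 \<or> j \<noteq> 1"
    using assms(2,7,8) GenHat by auto
  ultimately show ?thesis using assms(3-5) unfolding GenHat gen_perm_GenHat by (smt (z3))
qed

text \<open>Applying the generator to both entries of a pair maps the inversions of
  \<open>w \<circ> gen_perm g\<close> bijectively onto those of \<open>w\<close> other than the
  class of the root of \<open>g\<close>.\<close>

lemma card_inversions_descent:
  assumes g: "g \<in> gens_inf X" and desc: "right_descent w g"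
    and odd: "\<And>i. w (- i) = - w i" and fin: "finite (inversions X w)"
  shows "card (inversions X w) = Suc (card (inversions X (w \<circ> gen_perm g)))"
proof -
  let ?s = "gen_perm g" and ?M = "image (map_prod (gen_perm g) (gen_perm g))"
  obtain a b where ab: "gen_root g = (a, b)" by fastforce
  note root = gen_root_properties[OF g ab]
  have less: "w b < w a" using desc ab by (simp add: right_descent_def)
  have class_M: "?M (pair_class (i, j)) = pair_class (?s i, ?s j)" for i j
    by (simp add: gen_perm_uminus)
  have class_eq: "pair_class (i, j) = pair_class (a, b) \<longleftrightarrow> (i, j) = (a, b) \<or> (i, j) = (- b, - a)" for i j
    by (auto simp: doubleton_eq_iff)
  note [simp del] = pair_class.simps
  have fwd: "(?s i, ?s j) \<in> inv_pairs X w \<and> pair_class (?s i, ?s j) \<noteq> pair_class (a, b)"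
    if "(i, j) \<in> inv_pairs X (w \<circ> ?s)" for i j
  proof -
    have ij: "i < j" "i \<noteq> 0" "j \<noteq> 0" "X = TypeD \<Longrightarrow> i \<noteq> - j" "w (?s j) < w (?s i)"
      using that by (auto simp: inv_pairs_def)
    have "(i, j) \<noteq> (a, b)" "(i, j) \<noteq> (- b, - a)"
      using ij(5) less root(1,2) by (auto simp: gen_perm_uminus odd)
    then have "?s i < ?s j" using gen_perm_less[OF g ab] ij by blast
    moreover have "X = TypeD \<Longrightarrow> ?s i \<noteq> - ?s j"
      using ij(4) by (metis gen_perm_involution gen_perm_uminus)
    moreover have "(?s i, ?s j) \<noteq> (a, b)"
      using ij(1) root(1-3) by (metis gen_perm_involution less_asym prod.inject)
    moreover have "(?s i, ?s j) \<noteq> (- b, - a)"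
    proof
      assume "(?s i, ?s j) = (- b, - a)"
      then have "i = - a" "j = - b"
        using root(1,2) by (metis gen_perm_involution gen_perm_uminus prod.inject)+
      then show False using ij(1) root(3) by simp
    qed
    ultimately show ?thesis using ij(2,3,5) class_eq by (auto simp: inv_pairs_def)
  qed
  have bwd: "(?s i, ?s j) \<in> inv_pairs X (w \<circ> ?s)"
    if "(i, j) \<in> inv_pairs X w" "pair_class (i, j) \<noteq> pair_class (a, b)" for i j
  proof -
    have ij: "i < j" "i \<noteq> 0" "j \<noteq> 0" "X = TypeD \<Longrightarrow> i \<noteq> - j" "w j < w i"
      using that by (auto simp: inv_pairs_def)
    have "?s i < ?s j" using gen_perm_less[OF g ab] ij that(2) class_eq by blast
    moreover have "X = TypeD \<Longrightarrow> ?s i \<noteq> - ?s j"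
      using ij(4) by (metis gen_perm_involution gen_perm_uminus)
    ultimately show ?thesis using ij(2,3,5) by (auto simp: inv_pairs_def)
  qed
  have "inversions X w - {pair_class (a, b)} = ?M ` inversions X (w \<circ> ?s)" (is "?L = ?R")
  proof (intro equalityI subsetI)
    fix x assume "x \<in> ?L"
    then obtain p where p: "p \<in> inv_pairs X w" "x = pair_class p" "x \<noteq> pair_class (a, b)"
      unfolding inversions_def by blast
    obtain i j where "p = (i, j)" by fastforce
    with p have ij: "x = pair_class (i, j)" "(i, j) \<in> inv_pairs X w"
      "pair_class (i, j) \<noteq> pair_class (a, b)" by simp_all
    have "x = ?M (pair_class (?s i, ?s j))" using class_M[of "?s i" "?s j"] ij(1) by simp
    moreover have "pair_class (?s i, ?s j) \<in> inversions X (w \<circ> ?s)"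
      unfolding inversions_def using bwd[OF ij(2,3)] by (rule imageI)
    ultimately show "x \<in> ?R" by (rule image_eqI)
  next
    fix x assume "x \<in> ?R"
    then obtain p where p: "p \<in> inv_pairs X (w \<circ> ?s)" "x = ?M (pair_class p)"
      unfolding inversions_def by blast
    obtain i j where ij: "p = (i, j)" by fastforce
    have "x = pair_class (?s i, ?s j)" using p(2) class_M unfolding ij by metis
    with fwd[of i j] p(1) show "x \<in> ?L" unfolding inversions_def ij by blast
  qed
  moreover have "pair_class (a, b) \<in> inversions X w"
    using root less unfolding inversions_def by (intro imageI) (auto simp: inv_pairs_def)
  moreover have "card (?M ` inversions X (w \<circ> ?s)) = card (inversions X (w \<circ> ?s))"
  proof (rule card_image)
    have "inj (map_prod ?s ?s)" using inj_gen_perm by (simp add: prod.inj_map)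
    then show "inj_on ?M (inversions X (w \<circ> ?s))"
      by (meson inj_on_image inj_on_subset subset_UNIV)
  qed
  ultimately show ?thesis using fin by (metis card_Suc_Diff1)
qed

section \<open>The groups and their closure under multiplication by generators\<close>

lemma BC_bound:
  assumes "w \<in> BC n" "i \<noteq> 0" "\<bar>i\<bar> \<le> int n"
  shows "w i \<noteq> 0" "\<bar>w i\<bar> \<le> int n"
  using assms permutes_in_image[of w "{i. i \<noteq> 0 \<and> \<bar>i\<bar> \<le> int n}" i] by (auto simp: BC_def)

lemma BC_fixed: "w \<in> BC n \<Longrightarrow> int n < \<bar>i\<bar> \<or> i = 0 \<Longrightarrow> w i = i"
  by (auto simp: BC_def permutes_def)

lemma BC_uminus: "w \<in> BC n \<Longrightarrow> w (- i) = - w i"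
  by (simp add: BC_def)

lemma BC_inj: "w \<in> BC n \<Longrightarrow> inj w"
  unfolding BC_def using permutes_inj by blast

lemma finite_inversions:
  assumes "w \<in> BC n"
  shows "finite (inversions X w)"
proof -
  have "inv_pairs X w \<subseteq> {- int n..int n} \<times> {- int n..int n}"
  proof (intro subsetI)
    fix p assume "p \<in> inv_pairs X w"
    then obtain i j where p: "p = (i, j)" "i < j" "w j < w i" by (auto simp: inv_pairs_def)
    have bound: "w x = x \<and> int n < \<bar>x\<bar> \<or> \<bar>w x\<bar> \<le> int n \<and> \<bar>x\<bar> \<le> int n" for x
      using BC_bound(2)[OF assms] BC_fixed[OF assms]
      by (cases "x = 0"; cases "\<bar>x\<bar> \<le> int n"; force)
    show "p \<in> {- int n..int n} \<times> {- int n..int n}"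
      using bound[of i] bound[of j] p by auto
  qed
  then show ?thesis
    unfolding inversions_def by (meson finite_SigmaI finite_atLeastAtMost_int finite_imageI finite_subset)
qed

lemma gen_perm_BC:
  assumes "g \<in> gens X n" "min_rank X \<le> n"
  shows "gen_perm g \<in> BC n"
proof -
  let ?S = "{i. i \<noteq> 0 \<and> \<bar>i\<bar> \<le> int n}"
  have "gen_perm g i = i" if "i \<notin> ?S" for i
    using assms that
    by (cases g rule: gen_cases) (auto simp: gen_perm_apply gens_def min_rank_def split: if_splits)
  then have "gen_perm g permutes ?S"
    unfolding permutes_def by (metis gen_perm_involution)
  then show ?thesis by (simp add: BC_def gen_perm_uminus)
qed

lemma BC_comp: "u \<in> BC n \<Longrightarrow> v \<in> BC n \<Longrightarrow> u \<circ> v \<in> BC n"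
  by (auto simp: BC_def intro: permutes_compose)

lemma card_Collect_eq_sum:
  "finite A \<Longrightarrow> card {x \<in> A. P x} = (\<Sum>x\<in>A. of_bool (P x))"
  by (simp add: of_bool_def sum.If_cases Int_def)

text \<open>\<open>Gen (Suc k)\<close> only permutes the positive positions. \<open>GenHat\<close>
  replaces \<open>w 1\<close>, \<open>w 2\<close> by \<open>- w 2\<close>, \<open>- w 1\<close>;
  both are nonzero, so c negative ones among them become 2 - c, of the same parity.\<close>

lemma Dn_comp_gen:
  assumes w: "w \<in> Dn n" and g: "g \<in> gens TypeD n" and n: "2 \<le> n"
  shows "w \<circ> gen_perm g \<in> Dn n"
proof -
  have wBC: "w \<in> BC n" and even: "even (card {i \<in> {1..int n}. w i < 0})"
    using w by (auto simp: Dn_def)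
  have gBC: "gen_perm g \<in> BC n" using gen_perm_BC[OF g] n by (simp add: min_rank_def)
  have "even (card {i \<in> {1..int n}. w (gen_perm g i) < 0})"
  proof (cases g rule: gen_cases)
    case Gen_0
    then show ?thesis using g by (auto simp: gens_def)
  next
    case (Gen_Suc k)
    then have k: "Suc k < n" using g by (auto simp: gens_def)
    have maps: "gen_perm g i \<in> {1..int n}" if "i \<in> {1..int n}" for i
    proof -
      have "1 \<le> i" "i \<le> int n" "int k + 1 < int n" "0 \<le> int k" using that k by simp_all
      then show ?thesis unfolding Gen_Suc gen_perm_Gen_Suc atLeastAtMost_iff by (smt (verit))
    qed
    have "{i \<in> {1..int n}. w (gen_perm g i) < 0} = gen_perm g ` {i \<in> {1..int n}. w i < 0}" (is "?L = ?R")
    proof (intro equalityI subsetI)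
      fix x assume "x \<in> ?L"
      then have "gen_perm g x \<in> {i \<in> {1..int n}. w i < 0}" using maps[of x] by simp
      then show "x \<in> ?R" by (rule image_eqI[rotated]) simp
    next
      fix x assume "x \<in> ?R"
      then obtain y where "y \<in> {1..int n}" "w y < 0" "x = gen_perm g y" by blast
      then show "x \<in> ?L" using maps[of y] by simp
    qed
    then show ?thesis
      using even by (simp only: card_image[OF inj_on_subset[OF inj_gen_perm subset_UNIV]])
  next
    case GenHat
    have split: "{1..int n} = insert 1 (insert 2 {3..int n})" using n by auto
    have card: "card {i \<in> {1..int n}. v i < 0} =
      of_bool (v 1 < 0) + of_bool (v 2 < 0) + (\<Sum>i\<in>{3..int n}. of_bool (v i < 0))" for v :: "int \<Rightarrow> int"
      unfolding card_Collect_eq_sum[OF finite_atLeastAtMost_int] unfolding split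
      by (simp del: sum_of_bool_eq)
    have "(\<Sum>i\<in>{3..int n}. of_bool (w (gen_perm g i) < 0)) = (\<Sum>i\<in>{3..int n}. of_bool (w i < 0) :: nat)"
      by (intro sum.cong) (auto simp: GenHat gen_perm_GenHat)
    moreover have "w (gen_perm g 1) = - w 2" "w (gen_perm g 2) = - w 1"
      by (simp_all add: GenHat gen_perm_GenHat BC_uminus[OF wBC])
    moreover have "w 1 \<noteq> 0" "w 2 \<noteq> 0" using BC_bound(1)[OF wBC] n by auto
    ultimately show ?thesis
      using even unfolding card by (cases "w 1 < 0"; cases "w 2 < 0") simp_all
  qed
  then show ?thesis using BC_comp[OF wBC gBC] by (simp add: Dn_def)
qed

lemma grp_comp_gen:
  "w \<in> grp X n \<Longrightarrow> g \<in> gens X n \<Longrightarrow> min_rank X \<le> n \<Longrightarrow> w \<circ> gen_perm g \<in> grp X n"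
  using Dn_comp_gen BC_comp gen_perm_BC by (auto simp: grp_def min_rank_def split: if_splits)

text \<open>Multiplication from the left acts on the values, and these generators keep the sign of
  every value.\<close>

lemma gen_comp_grp:
  assumes w: "w \<in> grp X n" and i: "Suc i < n"
  shows "gen_perm (Gen (Suc i)) \<circ> w \<in> grp X n"
proof -
  have "gen_perm (Gen (Suc i)) x < 0 \<longleftrightarrow> x < 0" for x
    by (auto simp: gen_perm_apply)
  moreover have "gen_perm (Gen (Suc i)) \<in> BC n"
    using i by (intro gen_perm_BC[of _ TypeC]) (auto simp: gens_def min_rank_def)
  ultimately show ?thesis
    using w BC_comp by (auto simp: grp_def Dn_def split: if_splits)
qed

lemma grp_BC: "w \<in> grp X n \<Longrightarrow> w \<in> BC n"
  by (auto simp: grp_def Dn_def split: if_splits)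

lemma grp_mono:
  assumes "n \<le> m"
  shows "grp X n \<subseteq> grp X m"
proof
  fix w assume w: "w \<in> grp X n"
  note wBC = grp_BC[OF w]
  have "{i. i \<noteq> 0 \<and> \<bar>i\<bar> \<le> int n} \<subseteq> {i. i \<noteq> 0 \<and> \<bar>i\<bar> \<le> int m}" using assms by auto
  then have "w \<in> BC m" using wBC unfolding BC_def by (auto intro: permutes_subset)
  moreover have "{i \<in> {1..int m}. w i < 0} = {i \<in> {1..int n}. w i < 0}"
    using assms BC_fixed[OF wBC] by auto (metis abs_of_nonneg less_asym' linorder_not_less order_trans zero_le_one)
  ultimately show "w \<in> grp X m" using w by (auto simp: grp_def Dn_def)
qed

lemma gens_mono: "n \<le> m \<Longrightarrow> gens X n \<subseteq> gens X m"
  by (auto simp: gens_def)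

lemma grp_subset_grp_inf: "min_rank X \<le> n \<Longrightarrow> grp X n \<subseteq> grp_inf X"
  by (auto simp: grp_inf_def)

lemma grp_inf_gens_inf_common_rank:
  assumes "w \<in> grp_inf X" "g \<in> gens_inf X"
  obtains n where "min_rank X \<le> n" "w \<in> grp X n" "g \<in> gens X n"
proof -
  obtain n m where "min_rank X \<le> n" "w \<in> grp X n" "g \<in> gens X m"
    using assms by (auto simp: grp_inf_def gens_inf_def)
  then have "min_rank X \<le> max n m" "w \<in> grp X (max n m)" "g \<in> gens X (max n m)"
    using grp_mono[of n "max n m" X] gens_mono[of m "max n m" X] by auto
  then show ?thesis by (rule that)
qed

lemma grp_inf_comp_gen: "w \<in> grp_inf X \<Longrightarrow> g \<in> gens_inf X \<Longrightarrow> w \<circ> gen_perm g \<in> grp_inf X"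
  by (metis grp_inf_gens_inf_common_rank grp_comp_gen grp_subset_grp_inf subsetD)

lemma gen_comp_grp_inf:
  assumes "w \<in> grp_inf X"
  shows "gen_perm (Gen (Suc i)) \<circ> w \<in> grp_inf X"
proof -
  have "Gen (Suc i) \<in> gens_inf X" by (auto simp: gens_inf_eq)
  then obtain n where n: "min_rank X \<le> n" "w \<in> grp X n" "Gen (Suc i) \<in> gens X n"
    using grp_inf_gens_inf_common_rank[OF assms] by blast
  then have "Suc i < n" by (auto simp: gens_def split: if_splits)
  then show ?thesis using gen_comp_grp n grp_subset_grp_inf by blast
qed

lemma grp_inf_BC: "w \<in> grp_inf X \<Longrightarrow> \<exists>n. w \<in> BC n"
  using grp_BC by (auto simp: grp_inf_def)

lemma id_in_grp: "id \<in> grp X n"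
proof -
  have "{i \<in> {1..int n}. id i < 0} = {}" by auto
  then have "even (card {i \<in> {1..int n}. id i < 0})" by (simp only: card.empty even_zero)
  moreover have "id \<in> BC n" by (simp add: BC_def permutes_id)
  ultimately show ?thesis unfolding grp_def Dn_def by simp
qed

lemma not_descent_after_gen:
  assumes "w \<in> grp_inf X" "g \<in> gens_inf X"
  shows "right_descent (w \<circ> gen_perm g) g \<longleftrightarrow> \<not> right_descent w g"
proof -
  obtain a b where ab: "gen_root g = (a, b)" by fastforce
  have "w a \<noteq> w b"
    using gen_root_properties(3)[OF assms(2) ab] grp_inf_BC[OF assms(1)] BC_inj by (metis injD less_irrefl)
  then show ?thesis using gen_root_properties(1,2)[OF assms(2) ab] by (auto simp: right_descent_def ab)
qed

text \<open>If \<open>g\<close> is not a descent of \<open>w\<close>, it is one of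
  \<open>w \<circ> gen_perm g\<close>, and the descent case applies to that element.\<close>

lemma card_inversions_gen:
  assumes "w \<in> grp_inf X" "g \<in> gens_inf X"
  shows "if right_descent w g then card (inversions X w) = Suc (card (inversions X (w \<circ> gen_perm g)))
    else card (inversions X (w \<circ> gen_perm g)) = Suc (card (inversions X w))"
proof -
  have *: "card (inversions X v) = Suc (card (inversions X (v \<circ> gen_perm g)))"
    if "v \<in> grp_inf X" "right_descent v g" for v
    using card_inversions_descent[OF assms(2) that(2)] grp_inf_BC[OF that(1)] BC_uminus finite_inversions
    by blast
  show ?thesis
    using *[OF assms(1)] *[OF grp_inf_comp_gen[OF assms]] not_descent_after_gen[OF assms]
    by (auto simp: gen_perm_comp_self)
qed

text \<open>Without descents \<open>w\<close> increases on 1, ..., n. Once \<open>w 1\<close> is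
  positive, n integers increasing strictly between 1 and n leave only the identity.\<close>

lemma no_descents_id:
  assumes n: "min_rank X \<le> n" and w: "w \<in> grp X n" and nd: "\<And>g. g \<in> gens X n \<Longrightarrow> \<not> right_descent w g"
  shows "w = id"
proof -
  note wBC = grp_BC[OF w]
  note odd = BC_uminus[OF wBC]
  have n1: "1 \<le> n" using n by (auto simp: min_rank_def split: if_splits)
  have incr: "w (int i) < w (int i + 1)" if "1 \<le> i" "i < n" for i
  proof -
    define k where "k = i - 1"
    have k: "i = Suc k" using that by (simp add: k_def)
    have "\<not> right_descent w (Gen i)" using nd that by (auto simp: gens_def)
    moreover have "w (int i) \<noteq> w (int i + 1)" using BC_inj[OF wBC] by (metis injD less_add_one less_irrefl)
    ultimately show ?thesis by (simp add: right_descent_def k add.commute)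
  qed
  have w1: "0 < w 1"
  proof (cases "X = TypeD")
    case False
    then have "\<not> right_descent w (Gen 0)" using nd n1 by (auto simp: gens_def)
    moreover have "w 1 \<noteq> 0" using BC_bound(1)[OF wBC] n1 by auto
    ultimately show ?thesis by (auto simp: right_descent_def odd)
  next
    case True
    then have n2: "2 \<le> n" using n by (simp add: min_rank_def)
    have "\<not> right_descent w GenHat" using nd True by (auto simp: gens_def)
    then have "w 1 + w 2 \<ge> 0" by (auto simp: right_descent_def odd)
    moreover have "w 1 < w 2" using incr[of 1] n2 by simp
    ultimately have w2: "0 < w 2" by simp
    have pos: "0 < w (int i)" if "2 \<le> i" "i \<le> n" for i
      using that
    proof (induction i rule: dec_induct)
      case (step i)
      then show ?case using incr[of i] by (simp add: add.commute)
    qed (use w2 in simp)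
    show ?thesis
    proof (rule ccontr)
      assume "\<not> 0 < w 1"
      moreover have "w 1 \<noteq> 0" using BC_bound(1)[OF wBC] n1 by auto
      ultimately have "w 1 < 0" by simp
      moreover have "i = 1" if "1 \<le> i" "i \<le> int n" "w i < 0" for i
      proof (rule ccontr)
        assume "i \<noteq> 1"
        then have "2 \<le> nat i" "nat i \<le> n" using that by linarith+
        then have "0 < w i" using pos[of "nat i"] that by simp
        then show False using that by simp
      qed
      \<comment> \<open>In type D the inequality for \<open>GenHat\<close> makes all values from
        position 2 on positive; a negative \<open>w 1\<close> would then be the only negative value,
        against the parity condition.\<close>
      ultimately have "{i \<in> {1..int n}. w i < 0} = {1}"
        using n1 by auto
      then have "card {i \<in> {1..int n}. w i < 0} = 1" by simp
      then show False using w True by (simp add: grp_def Dn_def)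
    qed
  qed
  have ge: "int i \<le> w (int i)" if "1 \<le> i" "i \<le> n" for i
    using that
  proof (induction i rule: dec_induct)
    case (step i)
    then show ?case using incr[of i] by (simp add: add.commute)
  qed (use w1 in simp)
  \<comment> \<open>Induction downwards from position n, where the value is at most n;
    \<open>d\<close> is the distance from n.\<close>
  have le: "w (int (n - d)) \<le> int (n - d)" if "d < n" for d
    using that
  proof (induction d)
    case 0
    then show ?case using BC_bound(2)[OF wBC, of "int n"] by simp
  next
    case (Suc d)
    have "int (n - d) = int (n - Suc d) + 1" using Suc.prems by simp
    moreover have "1 \<le> n - Suc d" "n - Suc d < n" using Suc.prems by linarith+
    ultimately show ?case using incr[of "n - Suc d"] Suc by simp
  qed
  have pos: "w (int i) = int i" if "1 \<le> i" "i \<le> n" for i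
    using ge[OF that] le[of "n - i"] that by simp
  show ?thesis
  proof
    fix x
    consider "int n < \<bar>x\<bar> \<or> x = 0" | "0 < x" "x \<le> int n" | "x < 0" "- x \<le> int n" by linarith
    then show "w x = id x"
    proof cases
      case 1
      then show ?thesis using BC_fixed[OF wBC] by simp
    next
      case 2
      then show ?thesis using pos[of "nat x"] by simp
    next
      case 3
      then show ?thesis using pos[of "nat (- x)"] odd[of x] by simp
    qed
  qed
qed

section \<open>Words, and length as the number of inversions\<close>

lemma word_prod_Nil [simp]: "word_prod [] = id"
  by (simp add: word_prod_def)

lemma word_prod_snoc: "word_prod (gs @ [g]) = word_prod gs \<circ> gen_perm g"
proof (induction gs)
  case (Cons h gs)
  then show ?case by (simp add: word_prod_def comp_assoc)
qed (simp add: word_prod_def)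

lemma len_le: "set gs \<subseteq> G \<Longrightarrow> len G (word_prod gs) \<le> length gs"
  unfolding len_def by (rule Least_le) blast

lemma ex_reduced_word:
  assumes "set gs \<subseteq> G" "word_prod gs = w"
  shows "\<exists>hs. reduced_word G hs w"
proof -
  have "\<exists>hs. set hs \<subseteq> G \<and> word_prod hs = w \<and> length hs = len G w"
    unfolding len_def by (rule LeastI) (use assms in blast)
  then show ?thesis by (auto simp: reduced_word_def)
qed

text \<open>The last letter of a reduced word is a descent, and deleting it leaves a reduced word.
  This recursion matches that of the divided differences.\<close>

lemma reduced_word_snoc:
  assumes g: "g \<in> G"
  shows "reduced_word G (gs @ [g]) w \<longleftrightarrow>
    len G (w \<circ> gen_perm g) < len G w \<and> reduced_word G gs (w \<circ> gen_perm g)" (is "?L \<longleftrightarrow> ?R")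
proof -
  \<comment> \<open>Lengths are defined by \<open>LEAST\<close>, hence meaningful only if some word
    exists; \<open>gs\<close> guarantees one.\<close>
  have len_comp: "len G w \<le> Suc (len G (w \<circ> gen_perm g))"
    if gs: "set gs \<subseteq> G" "word_prod gs = w \<circ> gen_perm g" for gs
  proof -
    obtain hs where hs: "reduced_word G hs (w \<circ> gen_perm g)" using ex_reduced_word[OF gs] by blast
    have "word_prod (hs @ [g]) = w"
      using hs by (simp add: reduced_word_def word_prod_snoc gen_perm_comp_self)
    then show ?thesis using len_le[of "hs @ [g]" G] hs g by (simp add: reduced_word_def)
  qed
  show ?thesis
  proof
    assume L: ?L
    then have prod: "word_prod gs = w \<circ> gen_perm g"
      unfolding reduced_word_def word_prod_snoc using gen_perm_comp_self by metis
    then show ?R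
      using L len_comp[of gs] len_le[of gs G] by (auto simp: reduced_word_def)
  next
    assume R: ?R
    then have "word_prod (gs @ [g]) = w"
      by (simp add: reduced_word_def word_prod_snoc gen_perm_comp_self)
    then show ?L using R g len_comp[of gs] by (auto simp: reduced_word_def)
  qed
qed

text \<open>Each letter changes the number of inversions by exactly one, which bounds the length
  from below.\<close>

lemma card_inversions_word_prod:
  assumes "set gs \<subseteq> gens_inf X"
  shows "word_prod gs \<in> grp_inf X \<and> card (inversions X (word_prod gs)) \<le> length gs"
  using assms
proof (induction gs rule: rev_induct)
  case Nil
  have "inversions X id = {}" by (auto simp: inversions_def inv_pairs_def)
  moreover have "id \<in> grp_inf X" using id_in_grp[of X "min_rank X"] grp_subset_grp_inf[of X "min_rank X"] by blast
  ultimately show ?case unfolding word_prod_Nil by (simp only: card.empty list.size order_refl)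
next
  case (snoc g gs)
  then have "word_prod gs \<in> grp_inf X" "g \<in> gens_inf X" by auto
  then show ?case
    using snoc card_inversions_gen[of "word_prod gs" X g] grp_inf_comp_gen[of "word_prod gs" X g]
    unfolding word_prod_snoc by (simp del: o_apply split: if_splits)
qed

text \<open>Sorting: strip off descents, each removing one inversion, until the identity is
  reached.\<close>

lemma ex_word_of_length_inversions:
  assumes "min_rank X \<le> n" "w \<in> grp X n"
  shows "\<exists>gs. set gs \<subseteq> gens X n \<and> word_prod gs = w \<and> length gs = card (inversions X w)"
  using assms(2)
proof (induction "card (inversions X w)" arbitrary: w rule: less_induct)
  case less
  show ?case
  proof (cases "\<exists>g\<in>gens X n. right_descent w g")
    case False
    then have "w = id" using no_descents_id[OF assms(1) less.prems] by blast
    moreover have "inversions X id = {}" by (auto simp: inversions_def inv_pairs_def)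
    ultimately show ?thesis by (intro exI[of _ "[]"]) simp
  next
    case True
    then obtain g where g: "g \<in> gens X n" "right_descent w g" by blast
    let ?v = "w \<circ> gen_perm g"
    have "w \<in> grp_inf X" "g \<in> gens_inf X"
      using g less.prems grp_subset_grp_inf[OF assms(1)] gens_subset_gens_inf[OF assms(1)] by auto
    then have card: "card (inversions X w) = Suc (card (inversions X ?v))"
      using card_inversions_gen[of w X g] g by simp
    have "?v \<in> grp X n" using grp_comp_gen less.prems g assms(1) by blast
    then obtain gs where gs: "set gs \<subseteq> gens X n" "word_prod gs = ?v" "length gs = card (inversions X ?v)"
      using less.hyps[of ?v] card by auto
    show ?thesis
      using gs g card by (intro exI[of _ "gs @ [g]"]) (simp add: word_prod_snoc gen_perm_comp_self)
  qed
qed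

text \<open>With \<open>G\<close> anywhere between the two generating sets, this compares the length
  in rank n with the length in the infinite group: both count inversions.\<close>

lemma len_eq_card_inversions:
  assumes "min_rank X \<le> n" "w \<in> grp X n" "gens X n \<subseteq> G" "G \<subseteq> gens_inf X"
  shows "len G w = card (inversions X w)"
proof (rule antisym)
  obtain gs where gs: "set gs \<subseteq> gens X n" "word_prod gs = w" "length gs = card (inversions X w)"
    using ex_word_of_length_inversions[OF assms(1,2)] by blast
  then show "len G w \<le> card (inversions X w)" using len_le[of gs G] assms(3) by auto
  obtain hs where "reduced_word G hs w" using ex_reduced_word gs assms(3) by (metis order_trans)
  then show "card (inversions X w) \<le> len G w"
    using card_inversions_word_prod[of hs X] assms(4) by (auto simp: reduced_word_def)
qed

lemma len_gens_eq_len_gens_inf: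
  assumes "min_rank X \<le> n" "w \<in> grp X n"
  shows "len (gens X n) w = len (gens_inf X) w"
  using len_eq_card_inversions[OF assms] gens_subset_gens_inf[OF assms(1)] by simp

lemma len_gens_inf_less_iff:
  assumes "w \<in> grp_inf X" "g \<in> gens_inf X"
  shows "len (gens_inf X) (w \<circ> gen_perm g) < len (gens_inf X) w \<longleftrightarrow> right_descent w g"
proof -
  have "len (gens_inf X) v = card (inversions X v)" if "v \<in> grp_inf X" for v
    using that len_eq_card_inversions[of X _ v "gens_inf X"] gens_subset_gens_inf
    by (auto simp: grp_inf_def)
  then show ?thesis
    using card_inversions_gen[OF assms] assms(1) grp_inf_comp_gen[OF assms] by (auto split: if_splits)
qed

text \<open>Position i + 2 exceeds n and is fixed by \<open>w\<close>, while the value at i + 1 is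
  at most i + 1.\<close>

lemma no_descent_beyond_rank:
  assumes "min_rank X \<le> n" "w \<in> grp X n" "n \<le> Suc i"
  shows "\<not> len (gens_inf X) (w \<circ> gen_perm (Gen (Suc i))) < len (gens_inf X) w"
proof -
  have wBC: "w \<in> BC n" using grp_BC[OF assms(2)] .
  have "w (int i + 2) = int i + 2" using BC_fixed[OF wBC] assms(3) by simp
  moreover have "w (int i + 1) \<le> int i + 1"
  proof (cases "int i + 1 \<le> int n")
    case True
    then have "\<bar>w (int i + 1)\<bar> \<le> int n" using BC_bound(2)[OF wBC, of "int i + 1"] by simp
    then show ?thesis using assms(3) by linarith
  next
    case False
    then show ?thesis using BC_fixed[OF wBC, of "int i + 1"] by simp
  qed
  ultimately have "\<not> right_descent w (Gen (Suc i))" by (simp add: right_descent_def)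
  moreover have "Gen (Suc i) \<in> gens_inf X" by (auto simp: gens_inf_eq)
  ultimately show ?thesis
    using len_gens_inf_less_iff assms grp_subset_grp_inf by blast
qed

section \<open>Evaluation of double Schubert polynomials\<close>

text \<open>Indices are shifted as in \<open>svar\<close>: \<open>Z j\<close> is the value of
  z_(j+1), \<open>P m\<close> that of p_(2m+1), \<open>T j\<close> that of t_(j+1).\<close>

fun point :: "(nat \<Rightarrow> 'w mpoly) \<Rightarrow> (nat \<Rightarrow> 'w mpoly) \<Rightarrow> (nat \<Rightarrow> 'w mpoly) \<Rightarrow> svar \<Rightarrow> 'w mpoly" where
  "point Z P T (SZ j) = Z j"
| "point Z P T (SP m) = P m"
| "point Z P T (ST j) = T j"

fun act_z :: "gen \<Rightarrow> (nat \<Rightarrow> 'w mpoly) \<Rightarrow> nat \<Rightarrow> 'w mpoly" where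
  "act_z (Gen 0) Z = Z(0 := - Z 0)"
| "act_z (Gen (Suc i)) Z = Z \<circ> transpose i (Suc i)"
| "act_z GenHat Z = Z(0 := - Z 1, 1 := - Z 0)"

fun act_p :: "gen \<Rightarrow> (nat \<Rightarrow> 'w mpoly) \<Rightarrow> (nat \<Rightarrow> 'w mpoly) \<Rightarrow> nat \<Rightarrow> 'w mpoly" where
  "act_p (Gen 0) Z P = (\<lambda>m. P m + Z 0 ^ (2 * m + 1))"
| "act_p (Gen (Suc i)) Z P = P"
| "act_p GenHat Z P = (\<lambda>m. P m + Z 0 ^ (2 * m + 1) + Z 1 ^ (2 * m + 1))"

text \<open>Minus the value of \<open>z_denom\<close> at the point; for \<open>Gen 0\<close> in type
  B half of it, to offset the factor 2 in \<open>ddz_type\<close>.\<close>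

fun step_coeff :: "cltype \<Rightarrow> gen \<Rightarrow> (nat \<Rightarrow> 'w mpoly) \<Rightarrow> 'w mpoly" where
  "step_coeff X (Gen 0) Z = (if X = TypeB then Z 0 else 2 * Z 0)"
| "step_coeff X (Gen (Suc i)) Z = Z (Suc i) - Z i"
| "step_coeff X GenHat Z = Z 0 + Z 1"

lemma subst_point_z_image:
  "subst (point Z P T) (subst (z_image g) f) = subst (point (act_z g Z) (act_p g Z P) T) f"
proof -
  have "subst (point Z P T) (z_image g v) = point (act_z g Z) (act_p g Z P) T v" for v
    by (cases "(g, v)" rule: z_image.cases) (auto simp: subst_simps)
  then show ?thesis by (simp add: subst_subst)
qed

lemma subst_point_t_image:
  "subst (point Z P T) (subst (t_image (Gen (Suc i))) f) =
    subst (point Z P (T \<circ> transpose i (Suc i))) f"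
proof -
  have "subst (point Z P T) (t_image (Gen (Suc i)) v) = point Z P (T \<circ> transpose i (Suc i)) v" for v
    by (cases v) (auto simp: subst_simps)
  then show ?thesis by (simp add: subst_subst)
qed

text \<open>The outcome of overwriting position \<open>b\<close> by \<open>v\<close> and carrying
  \<open>v\<close> down to position \<open>a\<close> by adjacent exchanges.\<close>

definition slide :: "nat \<Rightarrow> nat \<Rightarrow> 'a \<Rightarrow> (nat \<Rightarrow> 'a) \<Rightarrow> nat \<Rightarrow> 'a" where
  "slide a b v Z = (\<lambda>j. if j = a then v else if a < j \<and> j \<le> b then Z (j - 1) else Z j)"

lemma slide_same: "slide a a v Z = Z(a := v)"
  by (rule ext) (auto simp: slide_def)

lemma slide_Suc: "a \<le> b \<Longrightarrow> slide a (Suc b) v Z = slide a b v (Z(Suc b := Z b))"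
  by (rule ext) (auto simp: slide_def)

lemma fun_upd_comp_transpose:
  "(Z(Suc b := v)) \<circ> transpose b (Suc b) = (Z(Suc b := Z b))(b := v)"
  by (rule ext) (auto simp: transpose_def)

text \<open>A function that does not see the order of the arguments from position \<open>a\<close> on and depends on
  finitely many of them ignores them all: fetch zeros from beyond the dependence bound.\<close>

lemma symmetric_tail_irrelevant:
  fixes f :: "(nat \<Rightarrow> 'a :: zero) \<Rightarrow> 'b"
  assumes sym: "\<And>i Z. a \<le> i \<Longrightarrow> f (Z \<circ> transpose i (Suc i)) = f Z"
    and fin: "\<And>Z Z'. (\<And>j. j < N \<Longrightarrow> Z j = Z' j) \<Longrightarrow> f Z = f Z'"
    and eq: "\<And>j. j < a \<Longrightarrow> Z j = Z' j"
  shows "f Z = f Z'"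
proof -
  have slide: "f (slide a b v Z) = f (Z(b := v))" if "a \<le> b" for b v Z
    using that
  proof (induction b arbitrary: Z rule: dec_induct)
    case base
    show ?case by (simp add: slide_same)
  next
    case (step b)
    have "f (slide a (Suc b) v Z) = f ((Z(Suc b := Z b))(b := v))"
      by (simp only: slide_Suc[OF step.hyps(1)] step.IH)
    also have "\<dots> = f (Z(Suc b := v))"
      using sym[of b "Z(Suc b := v)"] step.hyps by (simp only: fun_upd_comp_transpose)
    finally show ?case .
  qed
  \<comment> \<open>Inserts a zero at position \<open>a\<close>, pushing the whole tail one place
    further.\<close>
  define ins where "ins Z = (\<lambda>j. if j < a then Z j else if j = a then 0 else Z (j - 1))" for Z :: "nat \<Rightarrow> 'a"
  have f_ins: "f (ins Z) = f Z" for Z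
  proof -
    \<comment> \<open>Position N + a lies beyond the dependence bound, so a zero can be written
      there and carried down to \<open>a\<close>.\<close>
    have "f Z = f (Z(N + a := 0))" by (rule fin) simp
    also have "\<dots> = f (slide a (N + a) 0 Z)" by (simp add: slide)
    also have "\<dots> = f (ins Z)" by (rule fin) (auto simp: slide_def ins_def)
    finally show ?thesis by simp
  qed
  have f_ins_funpow: "f ((ins ^^ k) Z) = f Z" for k Z
    by (induction k) (auto simp: f_ins)
  have ins_funpow: "(ins ^^ k) Z j = (if j < a then Z j else if j < a + k then 0 else Z (j - k))" for k Z j
    by (induction k arbitrary: j) (auto simp: ins_def)
  \<comment> \<open>After N insertions, every position below N is either below \<open>a\<close> or
    holds a zero.\<close>
  have "f Z = f ((ins ^^ N) Z)" by (simp add: f_ins_funpow)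
  also have "\<dots> = f ((ins ^^ N) Z')" by (rule fin) (auto simp: ins_funpow eq)
  also have "\<dots> = f Z'" by (simp add: f_ins_funpow)
  finally show ?thesis .
qed

lemma svar_finite_bound:
  assumes "finite V"
  obtains N where "\<And>j. SZ j \<in> V \<Longrightarrow> j < N" "\<And>j. ST j \<in> V \<Longrightarrow> j < N"
proof -
  have "finite (SZ -` V \<union> ST -` V)"
    using assms by (auto intro!: finite_vimageI injI)
  then obtain N where "\<forall>j\<in>SZ -` V \<union> ST -` V. j < N"
    using finite_nat_set_iff_bounded by blast
  then show ?thesis using that[of N] by auto
qed

lemma subst_point_finite_dependence:
  fixes f :: "svar mpoly"
  obtains N where
    "\<And>Z Z' P T T' :: nat \<Rightarrow> 'w mpoly. (\<And>j. j < N \<Longrightarrow> Z j = Z' j) \<Longrightarrow> (\<And>j. j < N \<Longrightarrow> T j = T' j) \<Longrightarrow>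
      subst (point Z P T) f = subst (point Z' P T') f"
proof -
  obtain V where V: "finite V"
    "\<And>\<phi> \<psi> :: svar \<Rightarrow> 'w mpoly. (\<And>v. v \<in> V \<Longrightarrow> \<phi> v = \<psi> v) \<Longrightarrow> subst \<phi> f = subst \<psi> f"
    using subst_finite_dependence[where f = f and ?'w = 'w] by blast
  obtain N where N: "\<And>j. SZ j \<in> V \<Longrightarrow> j < N" "\<And>j. ST j \<in> V \<Longrightarrow> j < N"
    using svar_finite_bound[OF V(1)] by blast
  show ?thesis
  proof (rule that, rule V(2))
    fix Z Z' P T T' :: "nat \<Rightarrow> 'w mpoly" and v
    assume "\<And>j. j < N \<Longrightarrow> Z j = Z' j" "\<And>j. j < N \<Longrightarrow> T j = T' j" "v \<in> V"
    then show "point Z P T v = point Z' P T' v" using N by (cases v) auto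
  qed
qed

section \<open>Values of the double Schubert polynomials under changes of the point\<close>

locale double_schubert_family =
  fixes X :: cltype and F :: "(int \<Rightarrow> int) \<Rightarrow> svar mpoly"
  assumes double_schubert: "double_schubert X F"
begin

abbreviation "length_inf \<equiv> len (gens_inf X)"

lemma F_id: "F id = 1"
  using double_schubert by (simp add: double_schubert_def)

lemma subst_F_act_z:
  assumes w: "w \<in> grp_inf X" and g: "g \<in> gens_inf X"
  shows "subst (point (act_z g Z) (act_p g Z P) T) (F w) = subst (point Z P T) (F w) +
    (if length_inf (w \<circ> gen_perm g) < length_inf w then step_coeff X g Z * subst (point Z P T) (F (w \<circ> gen_perm g)) else 0)"
proof -
  have dd: "ddz_type X g (F w) = (if length_inf (w \<circ> gen_perm g) < length_inf w then F (w \<circ> gen_perm g) else 0)"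
    using double_schubert w g by (simp add: double_schubert_def)
  have "subst (point Z P T) (ddz_type X g (F w)) * step_coeff X g Z =
      - (subst (point Z P T) (ddz g (F w)) * subst (point Z P T) (z_denom g))"
    by (cases g rule: gen_cases) (auto simp: ddz_type_def subst_simps algebra_simps)
  then have "subst (point (act_z g Z) (act_p g Z P) T) (F w) =
      subst (point Z P T) (F w) + subst (point Z P T) (ddz_type X g (F w)) * step_coeff X g Z"
    unfolding subst_point_z_image[symmetric] subst_z_image by (simp add: subst_simps)
  then show ?thesis by (simp add: dd mult.commute)
qed

lemma subst_F_swap_t:
  assumes w: "w \<in> grp_inf X"
  shows "subst (point Z P (T \<circ> transpose i (Suc i))) (F w) = subst (point Z P T) (F w) -
    (if length_inf (gen_perm (Gen (Suc i)) \<circ> w) < length_inf w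
     then (T (Suc i) - T i) * subst (point Z P T) (F (gen_perm (Gen (Suc i)) \<circ> w)) else 0)"
proof -
  let ?g = "Gen (Suc i)"
  have "?g \<in> gens_inf X" by (auto simp: gens_inf_eq)
  then have "ddt_type X ?g (F w) = (if length_inf (gen_perm ?g \<circ> w) < length_inf w then F (gen_perm ?g \<circ> w) else 0)"
    using double_schubert w unfolding double_schubert_def by blast
  then have "ddt ?g (F w) = (if length_inf (gen_perm ?g \<circ> w) < length_inf w then F (gen_perm ?g \<circ> w) else 0)"
    by (simp add: ddt_type_def)
  then show ?thesis
    unfolding subst_point_t_image[symmetric] subst_t_image by (simp add: subst_simps)
qed

text \<open>Induction on the length: for \<open>w\<close> other than the identity, the value at z =
  t, p = 0 is symmetric in all of \<open>T\<close>, hence independent of \<open>T\<close>, hence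
  equal to the constant term, which is 0.\<close>

lemma subst_F_diagonal:
  fixes T :: "nat \<Rightarrow> 'w mpoly"
  assumes "w \<in> grp_inf X"
  shows "subst (point T (\<lambda>_. 0) T) (F w) = (if w = id then 1 else 0)"
  using assms
proof (induction "length_inf w" arbitrary: w T rule: less_induct)
  case less
  show ?case
  proof (cases "w = id")
    case True
    then show ?thesis by (simp add: F_id)
  next
    case False
    define f where "f T = subst (point T (\<lambda>_. 0) T) (F w)" for T :: "nat \<Rightarrow> 'w mpoly"
    have sym: "f (T \<circ> transpose i (Suc i)) = f T" for i T
    proof -
      let ?s = "gen_perm (Gen (Suc i))" and ?T = "T \<circ> transpose i (Suc i)" and ?d = "T (Suc i) - T i"
      have g: "Gen (Suc i) \<in> gens_inf X" by (auto simp: gens_inf_eq)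
      have ws: "w \<circ> ?s \<in> grp_inf X" and sw: "?s \<circ> w \<in> grp_inf X"
        using grp_inf_comp_gen[OF less.prems g] gen_comp_grp_inf[OF less.prems] by auto
      have sws: "?s \<circ> w \<circ> ?s \<in> grp_inf X" using grp_inf_comp_gen[OF sw g] .
      have ss: "?s \<circ> ?s = id" by auto
      \<comment> \<open>Exchanging entries in z and in t yields correction terms for ws, sw and sws.
        The last one vanishes by induction, since sws is not the identity. The first two vanish
        unless w = s, in which case both products are the identity and the terms cancel.\<close>
      have "?s \<circ> w \<circ> ?s \<noteq> id" using False by (metis (no_types, lifting) comp_assoc comp_id id_comp ss)
      moreover have eq: "w \<circ> ?s = id \<longleftrightarrow> ?s \<circ> w = id"
        by (metis (no_types, lifting) comp_assoc comp_id id_comp ss)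
      ultimately have IH:
        "length_inf (w \<circ> ?s) < length_inf w \<Longrightarrow> subst (point T (\<lambda>_. 0) T) (F (w \<circ> ?s)) = (if ?s \<circ> w = id then 1 else 0)"
        "length_inf (?s \<circ> w) < length_inf w \<Longrightarrow> subst (point T (\<lambda>_. 0) T) (F (?s \<circ> w)) = (if ?s \<circ> w = id then 1 else 0)"
        "length_inf (?s \<circ> w \<circ> ?s) < length_inf w \<Longrightarrow> subst (point T (\<lambda>_. 0) T) (F (?s \<circ> w \<circ> ?s)) = 0"
        using less.hyps[OF _ ws] less.hyps[OF _ sw] less.hyps[OF _ sws] by simp_all
      have z: "subst (point ?T (\<lambda>_. 0) T) (F v) = subst (point T (\<lambda>_. 0) T) (F v) +
          (if length_inf (v \<circ> ?s) < length_inf v then ?d * subst (point T (\<lambda>_. 0) T) (F (v \<circ> ?s)) else 0)"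
        if "v \<in> grp_inf X" for v
        using subst_F_act_z[OF that g, of T "\<lambda>_. 0" T] by simp
      have "f ?T = subst (point ?T (\<lambda>_. 0) T) (F w) -
          (if length_inf (?s \<circ> w) < length_inf w then ?d * subst (point ?T (\<lambda>_. 0) T) (F (?s \<circ> w)) else 0)"
        unfolding f_def using subst_F_swap_t[OF less.prems] by blast
      also have "\<dots> = f T"
      proof (cases "?s \<circ> w = id")
        case True
        have "w \<circ> ?s = ?s \<circ> w" using eq True by simp
        then show ?thesis
          unfolding z[OF less.prems] z[OF sw] f_def using IH by (auto simp del: o_apply)
      next
        case False
        then show ?thesis
          unfolding z[OF less.prems] z[OF sw] f_def using IH by (auto simp del: o_apply)
      qed
      finally show ?thesis .
    qed
    obtain N where N: "\<And>Z Z' P T T' :: nat \<Rightarrow> 'w mpoly. (\<And>j. j < N \<Longrightarrow> Z j = Z' j) \<Longrightarrow>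
      (\<And>j. j < N \<Longrightarrow> T j = T' j) \<Longrightarrow> subst (point Z P T) (F w) = subst (point Z' P T') (F w)"
      using subst_point_finite_dependence[of "F w"] by blast
    \<comment> \<open>With \<open>a = 0\<close> the irrelevant tail is the whole sequence.\<close>
    have "f T = f (\<lambda>_. 0)"
    proof (rule symmetric_tail_irrelevant[where f = f and a = 0 and N = N])
      show "f Z = f Z'" if "\<And>j. j < N \<Longrightarrow> Z j = Z' j" for Z Z'
        unfolding f_def using that by (intro N)
    qed (use sym in auto)
    also have "\<dots> = Const (Poly_Mapping.lookup (F w) 0)"
      unfolding f_def
    proof (rule subst_const_coeff)
      show "point (\<lambda>_. 0) (\<lambda>_. 0) (\<lambda>_. 0) v = 0" for v by (cases v) auto
    qed
    also have "\<dots> = 0"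
      using double_schubert less.prems False by (simp add: double_schubert_def Const_0)
    finally show ?thesis using False by (simp add: f_def)
  qed
qed

text \<open>No exchange from position n on is a descent of \<open>w\<close>, so \<open>F w\<close>
  is symmetric in z_n, z_(n+1), ... and these do not affect its value.\<close>

lemma subst_F_tail_irrelevant:
  fixes Z :: "nat \<Rightarrow> 'w mpoly"
  assumes n: "min_rank X \<le> n" and w: "w \<in> grp X n" and eq: "\<And>j. j < n - 1 \<Longrightarrow> Z j = Z' j"
  shows "subst (point Z P T) (F w) = subst (point Z' P T) (F w)"
proof -
  obtain N where N: "\<And>Z Z' P T T' :: nat \<Rightarrow> 'w mpoly. (\<And>j. j < N \<Longrightarrow> Z j = Z' j) \<Longrightarrow>
      (\<And>j. j < N \<Longrightarrow> T j = T' j) \<Longrightarrow> subst (point Z P T) (F w) = subst (point Z' P T') (F w)"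
    using subst_point_finite_dependence[of "F w"] by blast
  have w': "w \<in> grp_inf X" using w n grp_subset_grp_inf by blast
  show ?thesis
  proof (rule symmetric_tail_irrelevant[where f = "\<lambda>Z. subst (point Z P T) (F w)" and a = "n - 1" and N = N])
    show "subst (point (Z \<circ> transpose i (Suc i)) P T) (F w) = subst (point Z P T) (F w)"
      if "n - 1 \<le> i" for i Z
    proof -
      have g: "Gen (Suc i) \<in> gens_inf X" by (auto simp: gens_inf_eq)
      have "n \<le> Suc i" using that by simp
      then have "\<not> length_inf (w \<circ> gen_perm (Gen (Suc i))) < length_inf w"
        by (rule no_descent_beyond_rank[OF n w])
      then show ?thesis using subst_F_act_z[OF w' g, of Z P T] by simp
    qed
    show "subst (point Z P T) (F w) = subst (point Z' P T) (F w)" if "\<And>j. j < N \<Longrightarrow> Z j = Z' j" for Z Z'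
      using that by (intro N) auto
  qed (rule eq)
qed

end

section \<open>Sums over fillings\<close>

text \<open>Right multiplication by \<open>u_g\<close> in the nilCoxeter algebra, on
  coefficients.\<close>

definition descent_op :: "gen set \<Rightarrow> gen \<Rightarrow> ((int \<Rightarrow> int) \<Rightarrow> 'a) \<Rightarrow> (int \<Rightarrow> int) \<Rightarrow> 'a :: comm_ring_1" where
  "descent_op G g E w = (if len G (w \<circ> gen_perm g) < len G w then E (w \<circ> gen_perm g) else 0)"

text \<open>Regarding \<open>E\<close> as the element \<open>\<Sum>\<^sub>w E w u\<^sub>w\<close> of the nilCoxeter algebra, this is
  multiplication by \<open>1 + c u\<^sub>g\<close> from the right.\<close>

definition step_op :: "gen set \<Rightarrow> gen \<Rightarrow> 'a \<Rightarrow> ((int \<Rightarrow> int) \<Rightarrow> 'a) \<Rightarrow> (int \<Rightarrow> int) \<Rightarrow> 'a :: comm_ring_1" where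
  "step_op G g c E w = E w + c * descent_op G g E w"

text \<open>The factor contributed by one box, with one summand for each tile allowed in it.\<close>

definition box_op :: "cltype \<Rightarrow> gen set \<Rightarrow> ((int \<Rightarrow> int) \<Rightarrow> pvar mpoly) \<Rightarrow> box \<Rightarrow> (int \<Rightarrow> int) \<Rightarrow> pvar mpoly" where
  "box_op X G E b w = (\<Sum>\<tau>\<in>tiles (box_index X b). box_var b ^ weight \<tau> *
     foldl (\<lambda>E g. descent_op G g E) E (letters (box_index X b) \<tau>) w)"

lemma descent_op_twice: "descent_op G g (descent_op G g E) w = 0"
  by (simp add: descent_op_def gen_perm_comp_self del: o_apply)

lemma descent_op_step_op:
  "descent_op G h (step_op G g c E) w = descent_op G h E w + c * descent_op G h (descent_op G g E) w"
  by (simp add: descent_op_def[of G h] step_op_def)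

text \<open>As \<open>u_g\<close> squares to zero, the square of 1 + c u_g is 1 + 2c u_g. This
  merges the two boxes indexed 0 of type C.\<close>

lemma step_op_twice: "step_op G g c (step_op G g c E) = step_op G g (2 * c) E"
proof
  fix w
  have "step_op G g c (step_op G g c E) w =
      step_op G g c E w + c * descent_op G g (step_op G g c E) w"
    by (rule step_op_def)
  also have "\<dots> = step_op G g (2 * c) E w"
    unfolding descent_op_step_op descent_op_twice by (simp add: step_op_def algebra_simps)
  finally show "step_op G g c (step_op G g c E) w = step_op G g (2 * c) E w" .
qed

lemma box_op_Idx_0:
  "box_index X b = Idx 0 \<Longrightarrow> box_op X G E b = step_op G (Gen 0) (box_var b) E"
  by (rule ext) (simp add: box_op_def step_op_def)

lemma box_op_Idx_Suc:
  "box_index X b = Idx (Suc i) \<Longrightarrow> box_op X G E b = step_op G (Gen (Suc i)) (box_var b) E"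
  by (rule ext) (simp add: box_op_def step_op_def)

text \<open>The four tiles are the four terms in the expansion of a product of two linear factors;
  the elbow with two faucets is the quadratic term.\<close>

lemma box_op_OnePrime:
  assumes "box_index X b = OnePrime"
  shows "box_op X G E b = step_op G GenHat (box_var b) (step_op G (Gen 1) (box_var b) E)"
proof
  fix w
  let ?x = "box_var b"
  have "box_op X G E b w = E w + ?x * descent_op G (Gen 1) E w + ?x * descent_op G GenHat E w +
      ?x\<^sup>2 * descent_op G GenHat (descent_op G (Gen 1) E) w"
    using assms by (simp add: box_op_def algebra_simps)
  also have "\<dots> = step_op G (Gen 1) ?x E w + ?x * descent_op G GenHat (step_op G (Gen 1) ?x E) w"
    unfolding descent_op_step_op by (simp add: step_op_def algebra_simps power2_eq_square)
  also have "\<dots> = step_op G GenHat ?x (step_op G (Gen 1) ?x E) w"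
    by (rule step_op_def[symmetric])
  finally show "box_op X G E b w = step_op G GenHat ?x (step_op G (Gen 1) ?x E) w" .
qed

text \<open>Appended letters are removed from the right, one at a time, by
  \<open>reduced_word_snoc\<close>.\<close>

lemma sum_reduced_word_append:
  assumes "set hs \<subseteq> G"
  shows "(\<Sum>D\<in>A. if reduced_word G (wd D @ hs) w then m D else 0) =
    foldl (\<lambda>E g. descent_op G g E) (\<lambda>w. \<Sum>D\<in>A. if reduced_word G (wd D) w then m D else 0) hs w"
  using assms
proof (induction hs arbitrary: w rule: rev_induct)
  case (snoc g hs)
  have "reduced_word G (wd D @ hs @ [g]) w \<longleftrightarrow>
      len G (w \<circ> gen_perm g) < len G w \<and> reduced_word G (wd D @ hs) (w \<circ> gen_perm g)" for D
    using reduced_word_snoc[of g G "wd D @ hs" w] snoc.prems by simp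
  then show ?case
    using snoc.IH[of "w \<circ> gen_perm g"] snoc.prems by (simp add: descent_op_def del: o_apply)
qed simp

lemma sum_PiE_insert:
  assumes "finite S" "b \<notin> S"
  shows "(\<Sum>D\<in>PiE (insert b S) A. h D) = (\<Sum>\<tau>\<in>A b. \<Sum>D\<in>PiE S A. h (D(b := \<tau>)))"
proof -
  have "inj_on (\<lambda>(y, g). g(b := y)) (A b \<times> PiE S A)"
    using assms(2) by (rule inj_combinator)
  then have "(\<Sum>D\<in>PiE (insert b S) A. h D) = (\<Sum>(y, g)\<in>A b \<times> PiE S A. h (g(b := y)))"
    unfolding PiE_insert_eq by (subst sum.reindex) (auto simp: case_prod_unfold)
  then show ?thesis by (simp add: sum.cartesian_product)
qed

lemma finite_tiles: "finite (tiles i)"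
  by (cases i rule: tiles.cases) auto

lemma reduced_word_Nil: "reduced_word G [] w \<longleftrightarrow> w = id"
  using len_le[of "[]" G] by (auto simp: reduced_word_def simp del: o_apply)

text \<open>Stated for any list of distinct boxes so that the last box can be split off;
  distinctness keeps its tile from affecting the word and the monomial of the others.\<close>

lemma sum_fillings_eq_foldl:
  assumes "distinct bs"
    and "\<And>b \<tau>. b \<in> set bs \<Longrightarrow> \<tau> \<in> tiles (box_index X b) \<Longrightarrow> set (letters (box_index X b) \<tau>) \<subseteq> G"
  shows "(\<Sum>D\<in>(\<Pi>\<^sub>E b\<in>set bs. tiles (box_index X b)).
      if reduced_word G (concat (map (\<lambda>b. letters (box_index X b) (D b)) bs)) w
      then \<Prod>b\<in>set bs. box_var b ^ weight (D b) else 0) =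
    foldl (box_op X G) (\<lambda>w. if w = id then 1 else 0) bs w"
  using assms
proof (induction bs arbitrary: w rule: rev_induct)
  case Nil
  show ?case
    unfolding list.set list.map concat.simps PiE_empty_domain foldl.simps reduced_word_Nil by simp
next
  case (snoc b bs)
  let ?A = "\<lambda>b. tiles (box_index X b)"
  let ?word = "\<lambda>D. concat (map (\<lambda>b. letters (box_index X b) (D b)) bs)"
  let ?m = "\<lambda>D. \<Prod>b\<in>set bs. box_var b ^ weight (D b)"
  let ?E = "\<lambda>w. \<Sum>D\<in>PiE (set bs) ?A. if reduced_word G (?word D) w then ?m D else 0"
  have b: "b \<notin> set bs" and dist: "distinct bs" using snoc.prems by auto
  have E: "?E = foldl (box_op X G) (\<lambda>w. if w = id then 1 else 0) bs"
    by (intro ext snoc.IH[OF dist] snoc.prems(2)) auto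
  have word: "concat (map (\<lambda>b'. letters (box_index X b') ((D(b := \<tau>)) b')) (bs @ [b])) =
      ?word D @ letters (box_index X b) \<tau>" for D \<tau>
  proof -
    have "map (\<lambda>b'. letters (box_index X b') ((D(b := \<tau>)) b')) bs = map (\<lambda>b. letters (box_index X b) (D b)) bs"
      using b by (intro map_cong) auto
    then show ?thesis
      by (simp only: map_append concat_append list.map concat.simps fun_upd_same append_Nil2)
  qed
  have m: "(\<Prod>b'\<in>set (bs @ [b]). box_var b' ^ weight ((D(b := \<tau>)) b')) = box_var b ^ weight \<tau> * ?m D" for D \<tau>
  proof -
    have "(\<Prod>b'\<in>set bs. box_var b' ^ weight ((D(b := \<tau>)) b')) = ?m D"
      using b by (intro prod.cong) auto
    moreover have "set (bs @ [b]) = insert b (set bs)" by simp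
    ultimately show ?thesis by (simp only: prod.insert[OF finite_set b] fun_upd_same)
  qed
  have "(\<Sum>D\<in>PiE (set (bs @ [b])) ?A.
      if reduced_word G (concat (map (\<lambda>b. letters (box_index X b) (D b)) (bs @ [b]))) w
      then \<Prod>b\<in>set (bs @ [b]). box_var b ^ weight (D b) else 0) =
    (\<Sum>\<tau>\<in>?A b. \<Sum>D\<in>PiE (set bs) ?A. if reduced_word G (?word D @ letters (box_index X b) \<tau>) w
      then box_var b ^ weight \<tau> * ?m D else 0)"
  proof -
    have "set (bs @ [b]) = insert b (set bs)" by simp
    then show ?thesis
      unfolding word[symmetric] m[symmetric] by (simp only: sum_PiE_insert[OF finite_set b])
  qed
  also have "\<dots> = (\<Sum>\<tau>\<in>?A b. box_var b ^ weight \<tau> *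
      (\<Sum>D\<in>PiE (set bs) ?A. if reduced_word G (?word D @ letters (box_index X b) \<tau>) w then ?m D else 0))"
    by (simp add: sum_distrib_left if_distrib[of "(*) _"] cong: if_cong)
  also have "\<dots> = box_op X G ?E b w"
    unfolding box_op_def
    by (intro sum.cong refl arg_cong2[where f = "(*)"] sum_reduced_word_append snoc.prems(2)) auto
  finally show ?case unfolding E by (simp only: foldl_append foldl.simps)
qed

section \<open>Moving along the pipe dream\<close>

locale ranked_double_schubert_family = double_schubert_family +
  fixes n :: nat and T :: "nat \<Rightarrow> pvar mpoly"
  assumes rank: "min_rank X \<le> n"
begin

abbreviation "G \<equiv> gens X n"

text \<open>The invariant along the reading order: on the rank n group, the partial product
  \<open>E\<close> has the values of the double Schubert polynomials at the current point as
  coefficients.\<close>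

definition agrees :: "((int \<Rightarrow> int) \<Rightarrow> pvar mpoly) \<Rightarrow> (nat \<Rightarrow> pvar mpoly) \<Rightarrow> (nat \<Rightarrow> pvar mpoly) \<Rightarrow> bool" where
  "agrees E Z P \<longleftrightarrow> (\<forall>w\<in>grp X n. E w = subst (point Z P T) (F w))"

lemma n_pos: "1 \<le> n"
  using rank by (auto simp: min_rank_def split: if_splits)

lemma agrees_step:
  assumes "agrees E Z P" "g \<in> G"
  shows "agrees (step_op G g (step_coeff X g Z) E) (act_z g Z) (act_p g Z P)"
  unfolding agrees_def
proof
  fix w assume w: "w \<in> grp X n"
  have wg: "w \<circ> gen_perm g \<in> grp X n" using grp_comp_gen[OF w assms(2) rank] .
  have w': "w \<in> grp_inf X" using w grp_subset_grp_inf[OF rank] by blast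
  have g': "g \<in> gens_inf X" using assms(2) gens_subset_gens_inf[OF rank] by blast
  have "E w = subst (point Z P T) (F w)"
    "E (w \<circ> gen_perm g) = subst (point Z P T) (F (w \<circ> gen_perm g))"
    using assms(1) w wg unfolding agrees_def by blast+
  then show "step_op G g (step_coeff X g Z) E w = subst (point (act_z g Z) (act_p g Z P) T) (F w)"
    unfolding subst_F_act_z[OF w' g'] step_op_def descent_op_def
      len_gens_eq_len_gens_inf[OF rank w] len_gens_eq_len_gens_inf[OF rank wg] by simp
qed

lemma agrees_tail:
  assumes "agrees E Z P" "\<And>j. j < n - 1 \<Longrightarrow> Z j = Z' j"
  shows "agrees E Z' P"
  using assms subst_F_tail_irrelevant[OF rank, of _ Z Z'] unfolding agrees_def by metis

lemma agrees_swap: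
  assumes "agrees E Z P" "Suc i < n" "box_index X b = Idx (Suc i)" "box_var b = Z (Suc i) - Z i"
  shows "agrees (box_op X G E b) (Z \<circ> transpose i (Suc i)) P"
proof -
  have "Gen (Suc i) \<in> G" using assms(2) by (auto simp: gens_def)
  from agrees_step[OF assms(1) this] show ?thesis
    unfolding box_op_Idx_Suc[OF assms(3)] assms(4) by simp
qed

text \<open>Exchanging \<open>v\<close> with the entry \<open>Z j\<close> on its left contributes
  the coefficient \<open>v - Z j\<close>; the exchanges run from the right end to
  \<open>a\<close>.\<close>

lemma agrees_slide_down:
  assumes "a \<le> b" "b < n" "agrees E (Z(b := v)) P"
    and "\<And>j. a \<le> j \<Longrightarrow> j < b \<Longrightarrow> box_index X (f j) = Idx (Suc j)"
    and "\<And>j. a \<le> j \<Longrightarrow> j < b \<Longrightarrow> box_var (f j) = v - Z j"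
  shows "agrees (foldl (box_op X G) E (map f (rev [a..<b]))) (slide a b v Z) P"
  using assms
proof (induction b arbitrary: E Z rule: dec_induct)
  case base
  then show ?case by (simp add: slide_same)
next
  case (step b)
  have "agrees (box_op X G E (f b)) ((Z(Suc b := v)) \<circ> transpose b (Suc b)) P"
    by (rule agrees_swap[OF step.prems(2,1)]) (use step.prems(3,4) step.hyps in auto)
  then have swap: "agrees (box_op X G E (f b)) ((Z(Suc b := Z b))(b := v)) P"
    by (simp only: fun_upd_comp_transpose)
  have "agrees (foldl (box_op X G) (box_op X G E (f b)) (map f (rev [a..<b])))
      (slide a b v (Z(Suc b := Z b))) P"
    by (rule step.IH[OF _ swap]) (use step.prems(1,3,4) in auto)
  then show ?case
    unfolding slide_Suc[OF step.hyps(1)] using step.hyps(1) by simp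
qed

text \<open>The way back: \<open>v\<close> passes a zero on its right, with coefficient
  \<open>0 - v\<close>.\<close>

lemma agrees_slide_up:
  assumes "a \<le> b" "b < n" "agrees E ((\<lambda>_. 0)(a := v)) P"
    and "\<And>j. a \<le> j \<Longrightarrow> j < b \<Longrightarrow> box_index X (f j) = Idx (Suc j)"
    and "\<And>j. a \<le> j \<Longrightarrow> j < b \<Longrightarrow> box_var (f j) = - v"
  shows "agrees (foldl (box_op X G) E (map f [a..<b])) ((\<lambda>_. 0)(b := v)) P"
  using assms
proof (induction b rule: dec_induct)
  case (step b)
  let ?E = "foldl (box_op X G) E (map f [a..<b])"
  have "agrees ?E ((\<lambda>_. 0)(b := v)) P"
    by (intro step.IH step.prems(2)) (use step.prems in auto)
  then have "agrees (box_op X G ?E (f b)) (((\<lambda>_. 0)(b := v)) \<circ> transpose b (Suc b)) P"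
    by (rule agrees_swap) (use step.prems step.hyps in auto)
  moreover have "((\<lambda>_. 0)(b := v)) \<circ> transpose b (Suc b) = (\<lambda>_. 0)(Suc b := v)"
    by (rule ext) (auto simp: transpose_def)
  ultimately show ?case using step.hyps(1) by (simp del: fun_upd_apply)
qed simp

text \<open>Reindexes row r + 1 by the position \<open>j\<close> of the exchange, whose generator is
  then \<open>Gen (Suc j)\<close>, as \<open>agrees_slide_down\<close> expects.\<close>

lemma staircase_order_eq:
  "staircase_order B n = concat (map (\<lambda>r. map (\<lambda>j. B (Suc r) (Suc (j - r))) (rev [r..<n - 1])) [0..<n - 1])"
proof -
  have "[1..<n] = map Suc [0..<n - 1]"
    using n_pos by (simp add: map_Suc_upt)
  moreover have "map (B (Suc r)) (rev [1..<Suc (n - Suc r)]) = map (\<lambda>j. B (Suc r) (Suc (j - r))) (rev [r..<n - 1])"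
    if "r < n - 1" for r
  proof -
    have "[1..<Suc (n - Suc r)] = map (\<lambda>j. Suc (j - r)) [r..<n - 1]"
      by (rule nth_equalityI) (use that in \<open>auto simp del: upt_Suc\<close>)
    then show ?thesis by (simp add: rev_map)
  qed
  ultimately show ?thesis
    unfolding staircase_order_def by (intro arg_cong[where f = concat]) auto
qed

text \<open>\<open>S r\<close> is the point after r rows; row r + 1 brings \<open>v r\<close> from
  position n - 1 down to position r. Only positions below n - 1 have to be specified.\<close>

lemma agrees_staircase:
  assumes "agrees E (S 0) P"
    and idx: "\<And>i j. box_index X (B i j) = Idx (i + j - 1)"
    and var: "\<And>r j. r \<le> j \<Longrightarrow> j < n - 1 \<Longrightarrow> box_var (B (Suc r) (Suc (j - r))) = v r - S r j"
    and S: "\<And>r j. r < n - 1 \<Longrightarrow> j < n - 1 \<Longrightarrow> S (Suc r) j = slide r (n - 1) (v r) (S r) j"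
  shows "agrees (foldl (box_op X G) E (staircase_order B n)) (S (n - 1)) P"
proof -
  let ?row = "\<lambda>r. map (\<lambda>j. B (Suc r) (Suc (j - r))) (rev [r..<n - 1])"
  have "agrees (foldl (box_op X G) E (concat (map ?row [0..<r]))) (S r) P" if "r \<le> n - 1" for r
    using that
  proof (induction r)
    case 0
    then show ?case using assms(1) by simp
  next
    case (Suc r)
    let ?E = "foldl (box_op X G) E (concat (map ?row [0..<r]))"
    have "agrees ?E (S r) P" using Suc by simp
    \<comment> \<open>Position n - 1 holds z_n, which can be overwritten freely.\<close>
    then have "agrees ?E ((S r)(n - 1 := v r)) P"
      by (rule agrees_tail) simp
    then have "agrees (foldl (box_op X G) ?E (?row r)) (slide r (n - 1) (v r) (S r)) P"
      using Suc.prems n_pos by (intro agrees_slide_down) (auto simp: idx var)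
    then have "agrees (foldl (box_op X G) ?E (?row r)) (S (Suc r)) P"
      by (rule agrees_tail) (use Suc.prems S in auto)
    then show ?case by simp
  qed
  then show ?thesis unfolding staircase_order_eq by simp
qed

section \<open>The Gamma blocks\<close>

lemma agrees_corner_B:
  assumes "X = TypeB" "agrees E ((\<lambda>_. 0)(0 := x)) P" "box_var b = x" "box_index X b = Idx 0"
  shows "agrees (box_op X G E b) ((\<lambda>_. 0)(0 := - x)) (\<lambda>i. P i + x ^ (2 * i + 1))"
proof -
  have "Gen 0 \<in> G" using n_pos assms(1) by (auto simp: gens_def)
  from agrees_step[OF assms(2) this] show ?thesis
    unfolding box_op_Idx_0[OF assms(4)] assms(3) using assms(1) by simp
qed

lemma agrees_corner_C:
  assumes "X = TypeC" "agrees E ((\<lambda>_. 0)(0 := x)) P"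
    and "box_var b = x" "box_index X b = Idx 0" "box_var b' = x" "box_index X b' = Idx 0"
  shows "agrees (box_op X G (box_op X G E b) b') ((\<lambda>_. 0)(0 := - x)) (\<lambda>i. P i + x ^ (2 * i + 1))"
proof -
  have "Gen 0 \<in> G" using n_pos assms(1) by (auto simp: gens_def)
  from agrees_step[OF assms(2) this] show ?thesis
    unfolding box_op_Idx_0[OF assms(4)] box_op_Idx_0[OF assms(6)] assms(3,5) step_op_twice
    using assms(1) by simp
qed

text \<open>\<open>Gen 1\<close> moves \<open>x\<close> from position 1 to 0; then
  \<open>GenHat\<close> returns it to position 1 as \<open>- x\<close> and adds its powers to
  \<open>P\<close>. The neighbouring entry is zero, so both coefficients are
  \<open>x\<close>.\<close>

lemma agrees_corner_D:
  assumes "X = TypeD" "agrees E ((\<lambda>_. 0)(1 := x)) P" "box_var b = x" "box_index X b = OnePrime"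
  shows "agrees (box_op X G E b) ((\<lambda>_. 0)(1 := - x)) (\<lambda>i. P i + x ^ (2 * i + 1))"
proof -
  have "2 \<le> n" using rank assms(1) by (simp add: min_rank_def)
  then have g: "Gen (Suc 0) \<in> G" "GenHat \<in> G" using assms(1) by (auto simp: gens_def)
  have "agrees (step_op G (Gen (Suc 0)) x E) (((\<lambda>_. 0)(1 := x)) \<circ> transpose 0 (Suc 0)) P"
    using agrees_step[OF assms(2) g(1)] by simp
  moreover have "((\<lambda>_. 0)(1 := x)) \<circ> transpose 0 (Suc 0) = (\<lambda>_. 0)(0 := x)"
    by (rule ext) (auto simp: transpose_def)
  ultimately have "agrees (step_op G (Gen (Suc 0)) x E) ((\<lambda>_. 0)(0 := x)) P" by simp
  from agrees_step[OF this g(2)]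
  have "agrees (step_op G GenHat x (step_op G (Gen (Suc 0)) x E)) (act_z GenHat ((\<lambda>_. 0)(0 := x)))
      (act_p GenHat ((\<lambda>_. 0)(0 := x)) P)" by simp
  moreover have "act_z GenHat ((\<lambda>_. 0)(0 := x)) = (\<lambda>_. 0)(1 := - x)"
    by (rule ext) simp
  moreover have "act_p GenHat ((\<lambda>_. 0)(0 := x)) P = (\<lambda>i. P i + x ^ (2 * i + 1))"
    by (rule ext) simp
  ultimately show ?thesis
    unfolding box_op_OnePrime[OF assms(4)] assms(3) by simp
qed

text \<open>Treats all types at once: \<open>C\<close> is the effect of the corner and
  \<open>a\<close> the position at which the entry is reflected, 0 in types B and C and 1 in type
  D.\<close>

lemma agrees_gamma_arms:
  assumes a: "a \<le> n - 1" and E: "agrees E (\<lambda>_. 0) P"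
    and corner: "\<And>E. agrees E ((\<lambda>_. 0)(a := px m)) P \<Longrightarrow> agrees (C E) ((\<lambda>_. 0)(a := - px m)) P'"
  shows "agrees (foldl (box_op X G)
      (C (foldl (box_op X G) E (map (Horiz m) (rev [Suc a..<n])))) (map (Vert m) [Suc a..<n])) (\<lambda>_. 0) P'"
proof -
  have upt: "[Suc a..<n] = map Suc [a..<n - 1]" using n_pos by (simp add: map_Suc_upt)
  have n1: "n - 1 < n" using n_pos by simp
  let ?E = "foldl (box_op X G) E (map (\<lambda>j. Horiz m (Suc j)) (rev [a..<n - 1]))"
  have "agrees E ((\<lambda>_. 0)(n - 1 := px m)) P"
    using E by (rule agrees_tail) simp
  then have "agrees ?E (slide a (n - 1) (px m) (\<lambda>_. 0)) P"
    by (intro agrees_slide_down a n1) auto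
  moreover have "slide a (n - 1) (px m) (\<lambda>_. 0) = (\<lambda>_. 0)(a := px m)"
    by (rule ext) (auto simp: slide_def)
  ultimately have "agrees (C ?E) ((\<lambda>_. 0)(a := - px m)) P'"
    by (intro corner) simp
  then have "agrees (foldl (box_op X G) (C ?E) (map (\<lambda>j. Vert m (Suc j)) [a..<n - 1]))
      ((\<lambda>_. 0)(n - 1 := - px m)) P'"
    by (intro agrees_slide_up a n1) auto
  \<comment> \<open>The reflected entry is back at position n - 1, where it can be erased.\<close>
  then have "agrees (foldl (box_op X G) (C ?E) (map (\<lambda>j. Vert m (Suc j)) [a..<n - 1])) (\<lambda>_. 0) P'"
    by (rule agrees_tail) simp
  then show ?thesis unfolding upt by (simp add: rev_map[symmetric] comp_def)
qed

lemma agrees_gamma: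
  assumes E: "agrees E (\<lambda>_. 0) P"
  shows "agrees (foldl (box_op X G) E (gamma_order X n m)) (\<lambda>_. 0) (\<lambda>i. P i + px m ^ (2 * i + 1))"
proof (cases X)
  case TypeB
  have "agrees (foldl (box_op X G)
      (box_op X G (foldl (box_op X G) E (map (Horiz m) (rev [Suc 0..<n]))) (Corner m))
      (map (Vert m) [Suc 0..<n])) (\<lambda>_. 0) (\<lambda>i. P i + px m ^ (2 * i + 1))"
  proof (rule agrees_gamma_arms[OF _ E, where C = "\<lambda>E. box_op X G E (Corner m)"])
    show "agrees (box_op X G E (Corner m)) ((\<lambda>_. 0)(0 := - px m)) (\<lambda>i. P i + px m ^ (2 * i + 1))"
      if "agrees E ((\<lambda>_. 0)(0 := px m)) P" for E
      using TypeB that by (rule agrees_corner_B) (simp_all add: TypeB)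
  qed simp
  then show ?thesis using TypeB by simp
next
  case TypeC
  have "agrees (foldl (box_op X G)
      (box_op X G (box_op X G (foldl (box_op X G) E (map (Horiz m) (rev [Suc 0..<n]))) (Horiz m 0)) (Vert m 0))
      (map (Vert m) [Suc 0..<n])) (\<lambda>_. 0) (\<lambda>i. P i + px m ^ (2 * i + 1))"
  proof (rule agrees_gamma_arms[OF _ E, where C = "\<lambda>E. box_op X G (box_op X G E (Horiz m 0)) (Vert m 0)"])
    show "agrees (box_op X G (box_op X G E (Horiz m 0)) (Vert m 0)) ((\<lambda>_. 0)(0 := - px m)) (\<lambda>i. P i + px m ^ (2 * i + 1))"
      if "agrees E ((\<lambda>_. 0)(0 := px m)) P" for E
      using TypeC that by (rule agrees_corner_C) (simp_all add: TypeC)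
  qed simp
  moreover have "[0..<n] = 0 # [Suc 0..<n]" using n_pos by (simp add: upt_conv_Cons)
  ultimately show ?thesis using TypeC by simp
next
  case TypeD
  have "1 \<le> n - 1" using rank TypeD by (simp add: min_rank_def)
  then have "agrees (foldl (box_op X G)
      (box_op X G (foldl (box_op X G) E (map (Horiz m) (rev [Suc 1..<n]))) (Corner m))
      (map (Vert m) [Suc 1..<n])) (\<lambda>_. 0) (\<lambda>i. P i + px m ^ (2 * i + 1))"
  proof (rule agrees_gamma_arms[OF _ E, where C = "\<lambda>E. box_op X G E (Corner m)"])
    show "agrees (box_op X G E (Corner m)) ((\<lambda>_. 0)(1 := - px m)) (\<lambda>i. P i + px m ^ (2 * i + 1))"
      if "agrees E ((\<lambda>_. 0)(1 := px m)) P" for E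
      using TypeD that by (rule agrees_corner_D) (simp_all add: TypeD)
  qed
  then show ?thesis using TypeD by (simp add: numeral_2_eq_2)
qed

lemma agrees_gammas:
  assumes "agrees E (\<lambda>_. 0) P"
  shows "agrees (foldl (box_op X G) E (concat (map (gamma_order X n) ms))) (\<lambda>_. 0)
    (\<lambda>i. P i + (\<Sum>m\<leftarrow>ms. px m ^ (2 * i + 1)))"
  using assms
proof (induction ms arbitrary: E P)
  case (Cons m ms)
  from Cons.IH[OF agrees_gamma[OF Cons.prems, of m]] show ?case
    by (simp add: add.assoc)
qed simp

end

section \<open>Assembling the three kinds of blocks\<close>

lemma foldl_reading_order:
  assumes "double_schubert X F" "min_rank X \<le> n" "w \<in> grp X n"
  shows "foldl (box_op X (gens X n)) (\<lambda>w. if w = id then 1 else 0) (reading_order X n k) w =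
    truncation k (F w)"
proof -
  let ?T = "\<lambda>j. Var (PT j)" and ?op = "box_op X (gens X n)"
  interpret ranked_double_schubert_family X F n ?T
    by unfold_locales (use assms in auto)
  let ?E0 = "\<lambda>w. if w = id then 1 else 0 :: pvar mpoly"
  let ?E1 = "foldl ?op ?E0 (staircase_order Upper n)"
  let ?E2 = "foldl ?op ?E1 (concat (map (gamma_order X n) (rev [1..<Suc k])))"
  let ?E3 = "foldl ?op ?E2 (staircase_order Lower n)"
  let ?P = "\<lambda>i. \<Sum>m=1..k. px m ^ (2 * i + 1)"
  have "agrees ?E0 ?T (\<lambda>_. 0)"
    unfolding agrees_def using subst_F_diagonal grp_subset_grp_inf[OF assms(2)] by (metis subsetD)
  \<comment> \<open>After r rows the point is r zeros followed by t_1, t_2, ...; a zero passing t_j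
    contributes -t_j, the variable of column j.\<close>
  then have "agrees ?E1 (\<lambda>j. if j < n - 1 then 0 else ?T (j - (n - 1))) (\<lambda>_. 0)"
    by (intro agrees_staircase[where v = "\<lambda>_. 0" and S = "\<lambda>r j. if j < r then 0 else ?T (j - r)"])
      (auto simp: slide_def)
  then have "agrees ?E1 (\<lambda>_. 0) (\<lambda>_. 0)"
    by (rule agrees_tail) simp
  from agrees_gammas[OF this, of "rev [1..<Suc k]"]
  have "agrees ?E2 (\<lambda>_. 0) (\<lambda>i. \<Sum>m\<leftarrow>rev [1..<Suc k]. px m ^ (2 * i + 1))"
    by simp
  moreover have "(\<Sum>m\<leftarrow>rev [1..<Suc k]. px m ^ (2 * i + 1)) = ?P i" for i
  proof -
    have "(\<Sum>m\<leftarrow>rev [1..<Suc k]. px m ^ (2 * i + 1)) = (\<Sum>m\<in>set (rev [1..<Suc k]). px m ^ (2 * i + 1))"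
      by (rule sum_list_distinct_conv_sum_set) simp
    also have "set (rev [1..<Suc k]) = {1..k}" by auto
    finally show ?thesis .
  qed
  ultimately have "agrees ?E2 (\<lambda>_. 0) ?P" by (simp only:)
  \<comment> \<open>In row r + 1 the new entry z_(r+1) passes only zeros, so each of its
    coefficients is z_(r+1).\<close>
  then have "agrees ?E3 (\<lambda>j. if j < n - 1 then Var (PZ j) else 0) ?P"
    by (intro agrees_staircase[where v = "\<lambda>r. Var (PZ r)" and S = "\<lambda>r j. if j < r then Var (PZ j) else 0"])
      (auto simp: slide_def)
  then have "agrees ?E3 (\<lambda>j. Var (PZ j)) ?P"
    by (rule agrees_tail) simp
  then have "?E3 w = subst (point (\<lambda>j. Var (PZ j)) ?P ?T) (F w)"
    using assms(3) by (simp only: agrees_def)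
  moreover have "point (\<lambda>j. Var (PZ j)) ?P ?T = truncation_image k"
  proof
    show "point (\<lambda>j. Var (PZ j)) ?P ?T v = truncation_image k v" for v by (cases v) auto
  qed
  ultimately show ?thesis
    by (simp only: truncation_def reading_order_def foldl_append)
qed

section \<open>The boxes of the base: distinctness and admissible letters\<close>

lemma distinct_concat_map:
  assumes "distinct xs" "\<And>x. x \<in> set xs \<Longrightarrow> distinct (f x)"
    and "\<And>x y. x \<noteq> y \<Longrightarrow> set (f x) \<inter> set (f y) = {}"
  shows "distinct (concat (map f xs))"
  using assms(1,2)
proof (induction xs)
  case (Cons x xs)
  have "set (f x) \<inter> set (f y) = {}" if "y \<in> set xs" for y
    using that Cons.prems(1) by (intro assms(3)) auto
  then show ?case using Cons by auto
qed simp

lemma set_staircase_order: "b \<in> set (staircase_order B n) \<longleftrightarrow> (\<exists>i j. b = B i j \<and> 1 \<le> i \<and> 1 \<le> j \<and> i + j \<le> n)"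
proof -
  have "set (staircase_order B n) = (\<Union>i\<in>{1..<n}. B i ` {1..<Suc (n - i)})"
    unfolding staircase_order_def by (simp del: upt_Suc)
  then have "b \<in> set (staircase_order B n) \<longleftrightarrow> (\<exists>i j. b = B i j \<and> i \<in> {1..<n} \<and> j \<in> {1..<Suc (n - i)})"
    by blast
  moreover have "i \<in> {1..<n} \<and> j \<in> {1..<Suc (n - i)} \<longleftrightarrow> 1 \<le> i \<and> 1 \<le> j \<and> i + j \<le> n" for i j
    by auto
  ultimately show ?thesis by simp
qed

lemma distinct_staircase_order:
  assumes "\<And>i j i' j'. B i j = B i' j' \<Longrightarrow> i = i' \<and> j = j'"
  shows "distinct (staircase_order B n)"
  unfolding staircase_order_def
  by (intro distinct_concat_map) (auto simp: distinct_map inj_on_def dest: assms)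

fun gamma_number :: "box \<Rightarrow> nat" where
  "gamma_number (Corner m) = m"
| "gamma_number (Horiz m i) = m"
| "gamma_number (Vert m i) = m"
| "gamma_number _ = 0"

lemma set_gamma_order:
  "b \<in> set (gamma_order X n m) \<Longrightarrow> gamma_number b = m \<and> (\<forall>B\<in>{Lower, Upper}. \<forall>i j. b \<noteq> B i j)"
  by (cases X) auto

lemma distinct_reading_order: "distinct (reading_order X n k)"
proof -
  have "distinct (gamma_order X n m)" for m
    by (cases X) (auto simp: distinct_map inj_on_def)
  moreover have "set (gamma_order X n m) \<inter> set (gamma_order X n m') = {}" if "m \<noteq> m'" for m m'
    using that set_gamma_order by blast
  ultimately have "distinct (concat (map (gamma_order X n) (rev [1..<Suc k])))"
    by (intro distinct_concat_map) auto
  moreover have "distinct (staircase_order Upper n)" "distinct (staircase_order Lower n)"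
    by (rule distinct_staircase_order; simp)+
  ultimately show ?thesis
    unfolding reading_order_def
    by (auto simp: set_staircase_order simp del: upt_Suc dest!: set_gamma_order)
qed

text \<open>All indices are below n, and in type D no box is indexed 0: staircase indices start at
  1, those of the arms at 2, and the corner has index \<open>OnePrime\<close>.\<close>

lemma letters_in_gens:
  assumes n: "min_rank X \<le> n" and b: "b \<in> set (reading_order X n k)" and \<tau>: "\<tau> \<in> tiles (box_index X b)"
  shows "set (letters (box_index X b) \<tau>) \<subseteq> gens X n"
proof -
  have idx: "set (letters (Idx i) \<tau>) \<subseteq> gens X n" if "i < n" "i = 0 \<Longrightarrow> X \<noteq> TypeD" for i
    using that by (cases "(Idx i, \<tau>)" rule: letters.cases) (auto simp: gens_def)
  have one: "set (letters OnePrime \<tau>) \<subseteq> gens X n" if "X = TypeD"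
    using that n by (cases \<tau>) (auto simp: gens_def min_rank_def)
  consider i j where "b = Upper i j \<or> b = Lower i j" "1 \<le> i" "1 \<le> j" "i + j \<le> n"
    | m where "b \<in> set (gamma_order X n m)"
    using b unfolding reading_order_def by (auto simp: set_staircase_order)
  then show ?thesis
  proof cases
    case 1
    then have "box_index X b = Idx (i + j - 1)" "i + j - 1 < n" "i + j - 1 \<noteq> 0" by auto
    then show ?thesis using idx[of "i + j - 1"] by simp
  next
    case 2
    have "1 \<le> n" using n by (auto simp: min_rank_def split: if_splits)
    with 2 consider i where "box_index X b = Idx i" "i < n" "i = 0 \<Longrightarrow> X \<noteq> TypeD"
      | "box_index X b = OnePrime" "X = TypeD"
      by (cases X) auto
    then show ?thesis
    proof cases
      case 1
      then show ?thesis using idx by simp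
    next
      case 2
      then show ?thesis using one[OF 2(2)] by (simp only:)
    qed
  qed
qed

theorem corollary3p18:
  fixes X :: cltype and n k :: nat and w :: "int \<Rightarrow> int"
    and F :: "(int \<Rightarrow> int) \<Rightarrow> svar mpoly"
  assumes "double_schubert X F"
    and "n \<ge> min_rank X"
    and "w \<in> grp X n"
  shows "truncation k (F w) = (\<Sum>D\<in>DPD X n k w. pd_monomial X n k D)"
proof -
  have "finite (fillings X n k)"
    unfolding fillings_def base_def by (intro finite_PiE finite_tiles) simp
  then have "(\<Sum>D\<in>DPD X n k w. pd_monomial X n k D) =
      (\<Sum>D\<in>fillings X n k. if reduced_word (gens X n) (pd_word X n k D) w then pd_monomial X n k D else 0)"
    unfolding DPD_def by (rule sum.inter_filter)
  also have "\<dots> = foldl (box_op X (gens X n)) (\<lambda>w. if w = id then 1 else 0) (reading_order X n k) w"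
    unfolding fillings_def base_def pd_word_def pd_monomial_def
    using distinct_reading_order letters_in_gens[OF assms(2)] by (rule sum_fillings_eq_foldl)
  also have "\<dots> = truncation k (F w)"
    using assms by (rule foldl_reading_order)
  finally show ?thesis by simp
qed

end
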